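(* Let $p$ be a prime, $s$ a positive integer, and $(C_p)^s=\langle\sigma_1\rangle\times\cdots\times\langle\sigma_s\rangle$ a direct product of $s$ cyclic groups of order $p$, acting trivially on $\mathbb{C}$. Let $f\in Z^2((C_p)^s,\mathbb{C}^* )$ be such that its bicharacter $\alpha_f$ is congruent to $\alpha_i$ for some $0\le i\le\lfloor\frac s2\rfloor$. Then $\mathbb{C}^f*(C_p)^s$ is isomorphic to a direct sum of $p^{s-2i}$ copies of the algebra of $p^i\times p^i$ complex matrices: $$\mathbb{C}^f*(C_p)^s\cong\left(M_{p^i}(\mathbb{C})\right)^{p^{s-2i}}.$$ In particular, for $f_1,f_2\in Z^2((C_p)^s,\mathbb{C}^* )$, the twisted group algebras $\mathbb{C}^{f_1}*(C_p)^s$ and $\mathbb{C}^{f_2}*(C_p)^s$ are isometric if and only if they are isomorphic (as $\mathbb{C}$-algebras).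
   Context: For a finite group $G$ acting trivially on $\mathbb{C}$, $Z^2(G,\mathbb{C}^* )$ is the group of 2-cocycles $f:G\times G\to\mathbb{C}^*$, i.e. $f(g,h)f(gh,k)=f(h,k)f(g,hk)$. The twisted group algebra $\mathbb{C}^f*G$ is the associative $\mathbb{C}$-algebra with basis $\{u_g\}_{g\in G}$ and multiplication $u_gu_h=f(g,h)u_{gh}$. The Hamming weight of $\sum_g\beta_gu_g$ is the number of $g$ with $\beta_g\neq0$; an isometry between two twisted group algebras is a bijective $\mathbb{C}$-linear ring homomorphism preserving Hamming weights, and two such algebras are isometric if an isometry between them exists. An alternating bicharacter on $(C_p)^s$ is a function $\alpha:(C_p)^s\times(C_p)^s\to\mathbb{C}^*$ that is a group homomorphism in each argument with the other fixed and satisfies $\alpha(g,g)=1$ for all $g$ (hence $\alpha(g,h)=\alpha(h,g)^{-1}$). For $f\in Z^2((C_p)^s,\mathbb{C}^* )$, $\alpha_f(g,h):=f(g,h)f(h,g)^{-1}$; this is an alternating bicharacter. Two alternating bicharacters $\alpha,\alpha'$ are congruent if there is $\psi\in\mathrm{Aut}((C_p)^s)$ with $\alpha'(g,h)=\alpha(\psi(g),\psi(h))$ for all $g,h$. For $0\le i\le\lfloor\frac s2\rfloor$, $\alpha_i$ is the alternating bicharacter determined by its values for $j<l$: $\alpha_i(\sigma_j,\sigma_l)=\exp(\frac{2\pi\sqrt{-1}}{p})$ if $1\le j\le i$ and $l=j+i$, and $\alpha_i(\sigma_j,\sigma_l)=1$ otherwise. *)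

theory Defs
  imports
    "HOL-Algebra.Product_Groups"
    "HOL-Algebra.QuotRing"
    "HOL-Analysis.Complex_Transcendental"
    "Jordan_Normal_Form.Matrix"
begin

section \<open>Cocycles and twisted group algebras\<close>

text \<open>
  Complex algebras are represented by the record type \<^typ>\<open>(complex, 'a) module\<close> of HOL-Algebra,
  which extends rings by a scalar multiplication. (The locale of the same library for algebras is
  not applicable, since it demands commutativity.)
\<close>

definition Cstar :: "complex monoid" where
  "Cstar = \<lparr>carrier = - {0}, monoid.mult = (*), one = 1\<rparr>"

definition cocycles2 :: "('g, 'b) monoid_scheme \<Rightarrow> ('g \<Rightarrow> 'g \<Rightarrow> complex) set" where
  "cocycles2 G = {f.
     (\<forall>g\<in>carrier G. \<forall>h\<in>carrier G. f g h \<in> carrier Cstar) \<and>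
     (\<forall>g\<in>carrier G. \<forall>h\<in>carrier G. \<forall>k\<in>carrier G.
        f g h * f (g \<otimes>\<^bsub>G\<^esub> h) k = f h k * f g (h \<otimes>\<^bsub>G\<^esub> k))}"

definition basis_elem :: "'g \<Rightarrow> 'g \<Rightarrow> complex" where
  "basis_elem g = (\<lambda>k. if k = g then 1 else 0)"

text \<open>
  For a finite group, the element with coefficients \<open>\<beta>\<^sub>g\<close> is encoded as the function \<open>\<beta>\<close>, which
  vanishes outside the carrier. The multiplication is the bilinear extension of
  \<open>u\<^sub>g u\<^sub>h = f(g,h) u\<^sub>g\<^sub>h\<close>. Cocycles are not assumed normalized, so the unit element is
  \<open>f(1,1)\<^sup>-\<^sup>1 u\<^sub>1\<close>.
\<close>

definition twisted_group_algebra ::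
    "('g, 'b) monoid_scheme \<Rightarrow> ('g \<Rightarrow> 'g \<Rightarrow> complex) \<Rightarrow> (complex, 'g \<Rightarrow> complex) module" where
  "twisted_group_algebra G f =
    \<lparr>carrier = {a. \<forall>g. g \<notin> carrier G \<longrightarrow> a g = 0},
     monoid.mult = (\<lambda>a b k. \<Sum>g\<in>carrier G. \<Sum>h\<in>carrier G.
               a g * b h * (f g h * basis_elem (g \<otimes>\<^bsub>G\<^esub> h) k)),
     one = (\<lambda>k. inverse (f \<one>\<^bsub>G\<^esub> \<one>\<^bsub>G\<^esub>) * basis_elem \<one>\<^bsub>G\<^esub> k),
     zero = (\<lambda>k. 0),
     add = (\<lambda>a b k. a k + b k),
     smult = (\<lambda>c a k. c * a k)\<rparr>"

definition hamming_weight :: "('g, 'b) monoid_scheme \<Rightarrow> ('g \<Rightarrow> complex) \<Rightarrow> nat" where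
  "hamming_weight G a = card {g \<in> carrier G. a g \<noteq> 0}"


section \<open>Isomorphisms, isometries and direct sums\<close>

definition algebra_iso :: "('k, 'a) module \<Rightarrow> ('k, 'b) module \<Rightarrow> ('a \<Rightarrow> 'b) set" where
  "algebra_iso A B =
    {\<phi> \<in> ring_iso A B. \<forall>c. \<forall>x\<in>carrier A. \<phi> (c \<odot>\<^bsub>A\<^esub> x) = c \<odot>\<^bsub>B\<^esub> \<phi> x}"

definition algebra_isomorphic :: "('k, 'a) module \<Rightarrow> ('k, 'b) module \<Rightarrow> bool" where
  "algebra_isomorphic A B \<longleftrightarrow> algebra_iso A B \<noteq> {}"

definition isometries ::
    "('g, 'b) monoid_scheme \<Rightarrow> ('g \<Rightarrow> 'g \<Rightarrow> complex) \<Rightarrow>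
     ('h, 'c) monoid_scheme \<Rightarrow> ('h \<Rightarrow> 'h \<Rightarrow> complex) \<Rightarrow> (('g \<Rightarrow> complex) \<Rightarrow> ('h \<Rightarrow> complex)) set" where
  "isometries G f H f' =
    {\<phi> \<in> algebra_iso (twisted_group_algebra G f) (twisted_group_algebra H f').
       \<forall>a\<in>carrier (twisted_group_algebra G f). hamming_weight H (\<phi> a) = hamming_weight G a}"

definition isometric ::
    "('g, 'b) monoid_scheme \<Rightarrow> ('g \<Rightarrow> 'g \<Rightarrow> complex) \<Rightarrow>
     ('h, 'c) monoid_scheme \<Rightarrow> ('h \<Rightarrow> 'h \<Rightarrow> complex) \<Rightarrow> bool" where
  "isometric G f H f' \<longleftrightarrow> isometries G f H f' \<noteq> {}"

text \<open>The direct sum of \<open>n\<close> copies of \<open>A\<close>, with componentwise operations.\<close>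

definition algebra_power :: "('k, 'a) module \<Rightarrow> nat \<Rightarrow> ('k, nat \<Rightarrow> 'a) module" where
  "algebra_power A n =
    \<lparr>carrier = (\<Pi>\<^sub>E t\<in>{..<n}. carrier A),
     monoid.mult = (\<lambda>x y. \<lambda>t\<in>{..<n}. x t \<otimes>\<^bsub>A\<^esub> y t),
     one = (\<lambda>t\<in>{..<n}. \<one>\<^bsub>A\<^esub>),
     zero = (\<lambda>t\<in>{..<n}. \<zero>\<^bsub>A\<^esub>),
     add = (\<lambda>x y. \<lambda>t\<in>{..<n}. x t \<oplus>\<^bsub>A\<^esub> y t),
     smult = (\<lambda>c x. \<lambda>t\<in>{..<n}. c \<odot>\<^bsub>A\<^esub> x t)\<rparr>"

text \<open>
  \<^const>\<open>module_mat\<close> at square dimensions carries the matrix product and the identity matrix in its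
  ring fields, hence it is the full matrix algebra.
\<close>

definition matrix_algebra :: "nat \<Rightarrow> (complex, complex mat) module" where
  "matrix_algebra n = module_mat TYPE(complex) n n"


section \<open>Elementary abelian groups and alternating bicharacters\<close>

definition elem_abelian :: "nat \<Rightarrow> nat \<Rightarrow> (nat \<Rightarrow> int) monoid" where
  "elem_abelian p s = product_group {1..s} (\<lambda>_. integer_mod_group p)"

definition sigma :: "nat \<Rightarrow> nat \<Rightarrow> nat \<Rightarrow> int" where
  "sigma s j = (\<lambda>k\<in>{1..s}. if k = j then 1 else 0)"

definition alternating_bicharacter ::
    "('g, 'b) monoid_scheme \<Rightarrow> ('g \<Rightarrow> 'g \<Rightarrow> complex) \<Rightarrow> bool" where
  "alternating_bicharacter G \<alpha> \<longleftrightarrow>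
     (\<forall>g\<in>carrier G. (\<lambda>h. \<alpha> g h) \<in> hom G Cstar) \<and>
     (\<forall>h\<in>carrier G. (\<lambda>g. \<alpha> g h) \<in> hom G Cstar) \<and>
     (\<forall>g\<in>carrier G. \<alpha> g g = 1)"

definition bichar_of_cocycle :: "('g \<Rightarrow> 'g \<Rightarrow> complex) \<Rightarrow> 'g \<Rightarrow> 'g \<Rightarrow> complex" where
  "bichar_of_cocycle f g h = f g h * inverse (f h g)"

definition bichar_congruent ::
    "('g, 'b) monoid_scheme \<Rightarrow> ('g \<Rightarrow> 'g \<Rightarrow> complex) \<Rightarrow> ('g \<Rightarrow> 'g \<Rightarrow> complex) \<Rightarrow> bool" where
  "bichar_congruent G \<alpha> \<alpha>' \<longleftrightarrow>
     (\<exists>\<psi>\<in>iso G G. \<forall>g\<in>carrier G. \<forall>h\<in>carrier G. \<alpha>' g h = \<alpha> (\<psi> g) (\<psi> h))"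

definition is_alpha :: "nat \<Rightarrow> nat \<Rightarrow> nat \<Rightarrow> ((nat \<Rightarrow> int) \<Rightarrow> (nat \<Rightarrow> int) \<Rightarrow> complex) \<Rightarrow> bool" where
  "is_alpha p s i \<alpha> \<longleftrightarrow> alternating_bicharacter (elem_abelian p s) \<alpha> \<and>
     (\<forall>j\<in>{1..s}. \<forall>l\<in>{1..s}. j < l \<longrightarrow>
        \<alpha> (sigma s j) (sigma s l) =
          (if j \<le> i \<and> l = j + i then exp (2 * complex_of_real pi * \<i> / of_nat p) else 1))"

text \<open>
  For \<open>p\<close> prime and \<open>i \<le> s div 2\<close> a function with \<^const>\<open>is_alpha\<close> exists, and its values on the
  carrier are unique; see \<open>is_alpha_alpha\<close> and \<open>is_alpha_unique\<close> below. Only values outside the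
  carrier depend on the choice operator.
\<close>

definition alpha :: "nat \<Rightarrow> nat \<Rightarrow> nat \<Rightarrow> (nat \<Rightarrow> int) \<Rightarrow> (nat \<Rightarrow> int) \<Rightarrow> complex" where
  "alpha p s i = (SOME \<alpha>. is_alpha p s i \<alpha>)"


section \<open>Well-definedness of the twisted group algebra\<close>

lemma cocycle_one:
  assumes "group G" "f \<in> cocycles2 G" "g \<in> carrier G"
  shows "f \<one>\<^bsub>G\<^esub> g = f \<one>\<^bsub>G\<^esub> \<one>\<^bsub>G\<^esub>" "f g \<one>\<^bsub>G\<^esub> = f \<one>\<^bsub>G\<^esub> \<one>\<^bsub>G\<^esub>"
proof -
  interpret group G by fact
  have nz: "f g h \<noteq> 0" if "g \<in> carrier G" "h \<in> carrier G" for g h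
    using assms(2) that by (auto simp: cocycles2_def Cstar_def)
  have c: "f g h * f (g \<otimes>\<^bsub>G\<^esub> h) k = f h k * f g (h \<otimes>\<^bsub>G\<^esub> k)"
    if "g \<in> carrier G" "h \<in> carrier G" "k \<in> carrier G" for g h k
    using assms(2) that by (auto simp: cocycles2_def)
  show "f \<one>\<^bsub>G\<^esub> g = f \<one>\<^bsub>G\<^esub> \<one>\<^bsub>G\<^esub>"
    using c[of "\<one>\<^bsub>G\<^esub>" "\<one>\<^bsub>G\<^esub>" g] nz[of "\<one>\<^bsub>G\<^esub>" g] assms(3) by simp
  show "f g \<one>\<^bsub>G\<^esub> = f \<one>\<^bsub>G\<^esub> \<one>\<^bsub>G\<^esub>"
    using c[of g "\<one>\<^bsub>G\<^esub>" "\<one>\<^bsub>G\<^esub>"] nz[of g "\<one>\<^bsub>G\<^esub>"] assms(3) by simp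
qed

lemma twisted_group_algebra_ring:
  assumes G: "group G" "finite (carrier G)" and f: "f \<in> cocycles2 G"
  shows "ring (twisted_group_algebra G f)"
proof -
  interpret group G by (rule G(1))
  let ?A = "twisted_group_algebra G f"
  let ?C = "carrier G"
  have nz: "f g h \<noteq> 0" if "g \<in> ?C" "h \<in> ?C" for g h
    using f that by (auto simp: cocycles2_def Cstar_def)
  have coc: "f g h * f (g \<otimes>\<^bsub>G\<^esub> h) k = f h k * f g (h \<otimes>\<^bsub>G\<^esub> k)"
    if "g \<in> ?C" "h \<in> ?C" "k \<in> ?C" for g h k
    using f that by (auto simp: cocycles2_def)
  have pick: "(\<Sum>m\<in>?C. basis_elem g m * F m) = F g" if "g \<in> ?C" for g and F :: "'a \<Rightarrow> complex"
  proof -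
    have "(\<Sum>m\<in>?C. basis_elem g m * F m) = (\<Sum>m\<in>?C. if m = g then F m else 0)"
      by (rule sum.cong) (auto simp: basis_elem_def)
    then show ?thesis using that G(2) by simp
  qed
  have pick': "(\<Sum>m\<in>?C. F m * basis_elem m k) = F k" if "k \<in> ?C" for k and F :: "'a \<Rightarrow> complex"
  proof -
    have "(\<Sum>m\<in>?C. F m * basis_elem m k) = (\<Sum>m\<in>?C. if m = k then F m else 0)"
      by (rule sum.cong) (auto simp: basis_elem_def)
    then show ?thesis using that G(2) by simp
  qed
  have mdef: "x \<otimes>\<^bsub>?A\<^esub> y =
    (\<lambda>k. \<Sum>g\<in>?C. \<Sum>h\<in>?C. x g * y h * (f g h * basis_elem (g \<otimes>\<^bsub>G\<^esub> h) k))" for x y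
    by (simp add: twisted_group_algebra_def)
  have assoc: "(x \<otimes>\<^bsub>?A\<^esub> y) \<otimes>\<^bsub>?A\<^esub> z = x \<otimes>\<^bsub>?A\<^esub> (y \<otimes>\<^bsub>?A\<^esub> z)" for x y z
  proof
    fix k
    let ?B = "\<lambda>g h l. basis_elem (g \<otimes>\<^bsub>G\<^esub> h \<otimes>\<^bsub>G\<^esub> l) k"
    have "((x \<otimes>\<^bsub>?A\<^esub> y) \<otimes>\<^bsub>?A\<^esub> z) k = (\<Sum>m\<in>?C. \<Sum>l\<in>?C. \<Sum>g\<in>?C. \<Sum>h\<in>?C.
        basis_elem (g \<otimes>\<^bsub>G\<^esub> h) m *
          (x g * y h * z l * f g h * f m l * basis_elem (m \<otimes>\<^bsub>G\<^esub> l) k))"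
      by (unfold mdef sum_distrib_right, intro sum.cong refl) (simp add: mult_ac)
    also have "\<dots> = (\<Sum>l\<in>?C. \<Sum>g\<in>?C. \<Sum>h\<in>?C. \<Sum>m\<in>?C.
        basis_elem (g \<otimes>\<^bsub>G\<^esub> h) m *
          (x g * y h * z l * f g h * f m l * basis_elem (m \<otimes>\<^bsub>G\<^esub> l) k))"
      by (rule trans[OF sum.swap], rule sum.cong[OF refl], rule trans[OF sum.swap],
        rule sum.cong[OF refl], rule sum.swap)
    also have "\<dots> = (\<Sum>l\<in>?C. \<Sum>g\<in>?C. \<Sum>h\<in>?C.
          x g * y h * z l * (f g h * f (g \<otimes>\<^bsub>G\<^esub> h) l) * ?B g h l)"
      by (intro sum.cong refl) (subst pick, auto)
    also have "\<dots> = (\<Sum>g\<in>?C. \<Sum>h\<in>?C. \<Sum>l\<in>?C.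
          x g * y h * z l * (f g h * f (g \<otimes>\<^bsub>G\<^esub> h) l) * ?B g h l)"
      by (rule trans[OF sum.swap], rule sum.cong[OF refl], rule sum.swap)
    also have "\<dots> = (\<Sum>g\<in>?C. \<Sum>h\<in>?C. \<Sum>l\<in>?C. \<Sum>m\<in>?C.
        basis_elem (h \<otimes>\<^bsub>G\<^esub> l) m *
          (x g * y h * z l * f h l * f g m * basis_elem (g \<otimes>\<^bsub>G\<^esub> m) k))"
    proof (intro sum.cong refl)
      fix g h l assume *: "g \<in> ?C" "h \<in> ?C" "l \<in> ?C"
      then show "x g * y h * z l * (f g h * f (g \<otimes>\<^bsub>G\<^esub> h) l) * ?B g h l = (\<Sum>m\<in>?C.
        basis_elem (h \<otimes>\<^bsub>G\<^esub> l) m *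
          (x g * y h * z l * f h l * f g m * basis_elem (g \<otimes>\<^bsub>G\<^esub> m) k))"
        by (subst pick) (auto simp: coc m_assoc)
    qed
    also have "\<dots> = (\<Sum>g\<in>?C. \<Sum>m\<in>?C. \<Sum>h\<in>?C. \<Sum>l\<in>?C.
        basis_elem (h \<otimes>\<^bsub>G\<^esub> l) m *
          (x g * y h * z l * f h l * f g m * basis_elem (g \<otimes>\<^bsub>G\<^esub> m) k))"
      by (rule sum.cong[OF refl], rule trans[OF sum.cong[OF refl sum.swap] sum.swap])
    also have "\<dots> = (x \<otimes>\<^bsub>?A\<^esub> (y \<otimes>\<^bsub>?A\<^esub> z)) k"
      by (simp add: mdef sum_distrib_left sum_distrib_right mult_ac)
    finally show "((x \<otimes>\<^bsub>?A\<^esub> y) \<otimes>\<^bsub>?A\<^esub> z) k = (x \<otimes>\<^bsub>?A\<^esub> (y \<otimes>\<^bsub>?A\<^esub> z)) k" .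
  qed
  have one_def': "\<one>\<^bsub>?A\<^esub> g = basis_elem \<one>\<^bsub>G\<^esub> g * inverse (f \<one>\<^bsub>G\<^esub> \<one>\<^bsub>G\<^esub>)" for g
    by (simp add: twisted_group_algebra_def)
  have f1: "f \<one>\<^bsub>G\<^esub> \<one>\<^bsub>G\<^esub> \<noteq> 0" using nz by simp
  have supp: "a k = 0" if "a \<in> carrier ?A" "k \<notin> ?C" for a k
    using that by (simp add: twisted_group_algebra_def)
  have out: "basis_elem g k = 0" if "g \<in> ?C" "k \<notin> ?C" for g k
    using that by (auto simp: basis_elem_def)
  have one_l: "\<one>\<^bsub>?A\<^esub> \<otimes>\<^bsub>?A\<^esub> x = x" if x: "x \<in> carrier ?A" for x
  proof
    fix k
    have "(\<one>\<^bsub>?A\<^esub> \<otimes>\<^bsub>?A\<^esub> x) k = (\<Sum>h\<in>?C. \<Sum>g\<in>?C. basis_elem \<one>\<^bsub>G\<^esub> g *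
        (inverse (f \<one>\<^bsub>G\<^esub> \<one>\<^bsub>G\<^esub>) * x h * (f g h * basis_elem (g \<otimes>\<^bsub>G\<^esub> h) k)))"
      by (rule trans[OF _ sum.swap]) (simp add: mdef one_def' mult_ac)
    also have "\<dots> = (\<Sum>h\<in>?C. x h * basis_elem h k)"
    proof (rule sum.cong[OF refl])
      fix h assume h: "h \<in> ?C"
      show "(\<Sum>g\<in>?C. basis_elem \<one>\<^bsub>G\<^esub> g *
        (inverse (f \<one>\<^bsub>G\<^esub> \<one>\<^bsub>G\<^esub>) * x h * (f g h * basis_elem (g \<otimes>\<^bsub>G\<^esub> h) k))) = x h * basis_elem h k"
        using h f1 by (subst pick) (simp_all add: cocycle_one(1)[OF G(1) f h])
    qed
    also have "\<dots> = x k"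
      by (cases "k \<in> ?C") (simp_all add: pick' supp[OF x] out)
    finally show "(\<one>\<^bsub>?A\<^esub> \<otimes>\<^bsub>?A\<^esub> x) k = x k" .
  qed
  have one_r: "x \<otimes>\<^bsub>?A\<^esub> \<one>\<^bsub>?A\<^esub> = x" if x: "x \<in> carrier ?A" for x
  proof
    fix k
    have "(x \<otimes>\<^bsub>?A\<^esub> \<one>\<^bsub>?A\<^esub>) k = (\<Sum>g\<in>?C. \<Sum>h\<in>?C. basis_elem \<one>\<^bsub>G\<^esub> h *
        (inverse (f \<one>\<^bsub>G\<^esub> \<one>\<^bsub>G\<^esub>) * x g * (f g h * basis_elem (g \<otimes>\<^bsub>G\<^esub> h) k)))"
      by (simp add: mdef one_def' mult_ac)
    also have "\<dots> = (\<Sum>h\<in>?C. x h * basis_elem h k)"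
    proof (rule sum.cong[OF refl])
      fix h assume h: "h \<in> ?C"
      show "(\<Sum>g\<in>?C. basis_elem \<one>\<^bsub>G\<^esub> g *
        (inverse (f \<one>\<^bsub>G\<^esub> \<one>\<^bsub>G\<^esub>) * x h * (f h g * basis_elem (h \<otimes>\<^bsub>G\<^esub> g) k))) = x h * basis_elem h k"
        using h f1 by (subst pick) (simp_all add: cocycle_one(2)[OF G(1) f h])
    qed
    also have "\<dots> = x k"
      by (cases "k \<in> ?C") (simp_all add: pick' supp[OF x] out)
    finally show "(x \<otimes>\<^bsub>?A\<^esub> \<one>\<^bsub>?A\<^esub>) k = x k" .
  qed
  have closed: "x \<otimes>\<^bsub>?A\<^esub> y \<in> carrier ?A" for x y
    using out by (auto simp: twisted_group_algebra_def intro!: sum.neutral)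
  have one_closed: "\<one>\<^bsub>?A\<^esub> \<in> carrier ?A"
    using out by (auto simp: twisted_group_algebra_def)
  show ?thesis
  proof (rule ringI)
    show "abelian_group ?A"
    proof (rule abelian_groupI)
      fix x assume "x \<in> carrier ?A"
      then show "\<exists>y\<in>carrier ?A. y \<oplus>\<^bsub>?A\<^esub> x = \<zero>\<^bsub>?A\<^esub>"
        by (intro bexI[of _ "\<lambda>k. - x k"]) (auto simp: twisted_group_algebra_def)
    qed (auto simp: twisted_group_algebra_def add_ac)
    show "Group.monoid ?A"
      by (rule monoidI) (auto simp: closed one_closed assoc one_l one_r)
  qed (auto simp: twisted_group_algebra_def algebra_simps sum.distrib)
qed

lemma basis_elem_mult:
  assumes "finite (carrier G)" "g \<in> carrier G" "h \<in> carrier G"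
  shows "basis_elem g \<otimes>\<^bsub>twisted_group_algebra G f\<^esub> basis_elem h =
    f g h \<odot>\<^bsub>twisted_group_algebra G f\<^esub> basis_elem (g \<otimes>\<^bsub>G\<^esub> h)"
proof
  fix k
  have "(\<Sum>g'\<in>carrier G. \<Sum>h'\<in>carrier G.
      basis_elem g g' * basis_elem h h' * (f g' h' * basis_elem (g' \<otimes>\<^bsub>G\<^esub> h') k)) =
    (\<Sum>g'\<in>carrier G. if g' = g then (\<Sum>h'\<in>carrier G. if h' = h then
      f g h * basis_elem (g \<otimes>\<^bsub>G\<^esub> h) k else 0) else 0)"
    by (auto simp: basis_elem_def intro!: sum.cong sum.neutral)
  then show "(basis_elem g \<otimes>\<^bsub>twisted_group_algebra G f\<^esub> basis_elem h) k =
    (f g h \<odot>\<^bsub>twisted_group_algebra G f\<^esub> basis_elem (g \<otimes>\<^bsub>G\<^esub> h)) k"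
    using assms by (simp add: twisted_group_algebra_def)
qed


section \<open>Existence and uniqueness of the standard bicharacters\<close>

lemma group_elem_abelian: "group (elem_abelian p s)"
  by (simp add: elem_abelian_def)

lemma carrier_elem_abelian:
  "p > 0 \<Longrightarrow> carrier (elem_abelian p s) = {1..s} \<rightarrow>\<^sub>E {0..<int p}"
  by (simp add: elem_abelian_def carrier_integer_mod_group)

lemma mult_elem_abelian:
  "x \<otimes>\<^bsub>elem_abelian p s\<^esub> y = (\<lambda>k\<in>{1..s}. (x k + y k) mod int p)"
  by (simp add: elem_abelian_def)

lemma sigma_carrier: "p > 1 \<Longrightarrow> sigma s j \<in> carrier (elem_abelian p s)"
  by (auto simp: carrier_elem_abelian sigma_def)

lemma finite_elem_abelian: "p > 0 \<Longrightarrow> finite (carrier (elem_abelian p s))"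
  by (simp add: carrier_elem_abelian finite_PiE)

lemma group_Cstar: "group Cstar"
  by (rule groupI) (auto simp: Cstar_def intro!: bexI[of _ "inverse _"])

definition alpha_formula ::
    "nat \<Rightarrow> nat \<Rightarrow> (nat \<Rightarrow> int) \<Rightarrow> (nat \<Rightarrow> int) \<Rightarrow> complex" where
  "alpha_formula p i x y = exp (2 * complex_of_real pi * \<i> / of_nat p) powi
     (\<Sum>j\<in>{1..i}. x j * y (j + i) - x (j + i) * y j)"

lemma root_of_unity_powi_cong:
  assumes "p > 0" "int p dvd m - n"
  shows "exp (2 * complex_of_real pi * \<i> / of_nat p) powi m =
         exp (2 * complex_of_real pi * \<i> / of_nat p) powi n"
proof -
  let ?w = "exp (2 * complex_of_real pi * \<i> / of_nat p)"
  have w: "?w powi int p = 1"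
  proof -
    have "?w ^ p = exp (of_nat p * (2 * complex_of_real pi * \<i> / of_nat p))"
      by (simp only: exp_of_nat_mult)
    also have "\<dots> = exp (2 * complex_of_real pi * \<i>)" using assms(1) by simp
    finally show ?thesis by (simp add: exp_two_pi_i)
  qed
  obtain q where "m - n = int p * q" using assms(2) by (auto elim: dvdE)
  then have m: "m = n + int p * q" by simp
  have "?w powi m = ?w powi n * ?w powi (int p * q)"
    unfolding m by (rule power_int_add) simp
  also have "?w powi (int p * q) = 1"
    by (simp only: power_int_mult w power_int_1_left)
  finally show ?thesis by simp
qed

lemma alpha_formula_is_alpha:
  assumes p: "p > 1" and i: "i \<le> s div 2"
  shows "is_alpha p s i (alpha_formula p i)"
proof -
  let ?G = "elem_abelian p s"
  let ?w = "exp (2 * complex_of_real pi * \<i> / of_nat p)"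
  have p0: "p > 0" using p by simp
  have idx: "j \<in> {1..s}" "j + i \<in> {1..s}" if "j \<in> {1..i}" for j using that i by auto
  have add: "alpha_formula p i x (y \<otimes>\<^bsub>?G\<^esub> z) = alpha_formula p i x y * alpha_formula p i x z"
    for x y z
  proof -
    have "int p dvd (\<Sum>j\<in>{1..i}. x j * (y \<otimes>\<^bsub>?G\<^esub> z) (j + i) - x (j + i) * (y \<otimes>\<^bsub>?G\<^esub> z) j) -
      ((\<Sum>j\<in>{1..i}. x j * y (j + i) - x (j + i) * y j) +
       (\<Sum>j\<in>{1..i}. x j * z (j + i) - x (j + i) * z j))"
      unfolding sum.distrib[symmetric] sum_subtractf[symmetric]
    proof (rule dvd_sum)
      fix j assume j: "j \<in> {1..i}"
      have 1: "int p dvd (y \<otimes>\<^bsub>?G\<^esub> z) k - (y k + z k)" if "k \<in> {1..s}" for k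
        using that by (simp add: mult_elem_abelian mod_eq_dvd_iff[symmetric])
      have "x j * (y \<otimes>\<^bsub>?G\<^esub> z) (j + i) - x (j + i) * (y \<otimes>\<^bsub>?G\<^esub> z) j -
         (x j * y (j + i) - x (j + i) * y j + (x j * z (j + i) - x (j + i) * z j)) =
         x j * ((y \<otimes>\<^bsub>?G\<^esub> z) (j + i) - (y (j + i) + z (j + i))) -
         x (j + i) * ((y \<otimes>\<^bsub>?G\<^esub> z) j - (y j + z j))"
        by (simp add: algebra_simps)
      also have "int p dvd \<dots>" using idx[OF j] by (intro dvd_diff dvd_mult[OF 1])
      finally show "int p dvd x j * (y \<otimes>\<^bsub>?G\<^esub> z) (j + i) - x (j + i) * (y \<otimes>\<^bsub>?G\<^esub> z) j -
         (x j * y (j + i) - x (j + i) * y j + (x j * z (j + i) - x (j + i) * z j))" .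
    qed
    from root_of_unity_powi_cong[OF p0 this] show ?thesis
      by (simp add: alpha_formula_def power_int_add)
  qed
  have anti: "alpha_formula p i x y = inverse (alpha_formula p i y x)" for x y
  proof -
    have "(\<Sum>j\<in>{1..i}. x j * y (j + i) - x (j + i) * y j) =
      - (\<Sum>j\<in>{1..i}. y j * x (j + i) - y (j + i) * x j)"
      unfolding sum_negf[symmetric] by (rule sum.cong) (auto simp: algebra_simps)
    then show ?thesis by (simp add: alpha_formula_def power_int_minus)
  qed
  have nz: "alpha_formula p i x y \<noteq> 0" for x y by (simp add: alpha_formula_def)
  have add_l: "alpha_formula p i (x \<otimes>\<^bsub>?G\<^esub> z) y = alpha_formula p i x y * alpha_formula p i z y"
    for x y z
    by (simp only: anti[of _ y] add inverse_mult_distrib)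
  have "(\<lambda>y. alpha_formula p i x y) \<in> hom ?G Cstar" for x
    using nz add by (auto simp: hom_def Cstar_def)
  moreover have "(\<lambda>x. alpha_formula p i x y) \<in> hom ?G Cstar" for y
    using nz add_l by (auto simp: hom_def Cstar_def)
  moreover have "alpha_formula p i x x = 1" for x
    by (simp add: alpha_formula_def mult.commute)
  moreover have "alpha_formula p i (sigma s j) (sigma s l) =
     (if j \<le> i \<and> l = j + i then ?w else 1)"
    if jl: "j \<in> {1..s}" "l \<in> {1..s}" "j < l" for j l
  proof -
    have "(\<Sum>t\<in>{1..i}. sigma s j t * sigma s l (t + i) - sigma s j (t + i) * sigma s l t) =
      (\<Sum>t\<in>{1..i}. if t = j then (if l = j + i then 1 else 0) else 0)"
    proof (rule sum.cong)
      fix t assume "t \<in> {1..i}"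
      then show "sigma s j t * sigma s l (t + i) - sigma s j (t + i) * sigma s l t =
        (if t = j then (if l = j + i then 1 else 0) else 0)"
        using idx[of t] jl by (auto simp: sigma_def)
    qed simp
    also have "\<dots> = (if j \<le> i \<and> l = j + i then 1 else 0)" using jl by simp
    finally show ?thesis by (simp add: alpha_formula_def)
  qed
  ultimately show ?thesis
    unfolding is_alpha_def alternating_bicharacter_def by blast
qed

lemma is_alpha_alpha:
  assumes "p > 1" "i \<le> s div 2"
  shows "is_alpha p s i (alpha p s i)"
  unfolding alpha_def by (rule someI[of "is_alpha p s i", OF alpha_formula_is_alpha[OF assms]])

lemma hom_determined_by_sigma:
  assumes p: "p > 1"
    and \<theta>: "\<theta> \<in> hom (elem_abelian p s) Cstar" and \<eta>: "\<eta> \<in> hom (elem_abelian p s) Cstar"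
    and eq: "\<And>j. j \<in> {1..s} \<Longrightarrow> \<theta> (sigma s j) = \<eta> (sigma s j)"
    and x: "x \<in> carrier (elem_abelian p s)"
  shows "\<theta> x = \<eta> x"
proof -
  let ?G = "elem_abelian p s"
  interpret group ?G by (rule group_elem_abelian)
  have hm: "\<theta> (a \<otimes>\<^bsub>?G\<^esub> b) = \<theta> a * \<theta> b" "\<eta> (a \<otimes>\<^bsub>?G\<^esub> b) = \<eta> a * \<eta> b"
    if "a \<in> carrier ?G" "b \<in> carrier ?G" for a b
    using that \<theta> \<eta> by (auto simp: hom_def Cstar_def)
  have one: "\<theta> \<one>\<^bsub>?G\<^esub> = 1" "\<eta> \<one>\<^bsub>?G\<^esub> = 1"
    using hom_one[OF \<theta> group_elem_abelian group_Cstar]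
      hom_one[OF \<eta> group_elem_abelian group_Cstar] by (auto simp: Cstar_def)
  have c: "carrier ?G = {1..s} \<rightarrow>\<^sub>E {0..<int p}" using p by (simp add: carrier_elem_abelian)
  have "\<forall>x\<in>carrier ?G. (\<Sum>k\<in>{1..s}. nat (x k)) = n \<longrightarrow> \<theta> x = \<eta> x" for n
  proof (induction n)
    case 0
    have "x = \<one>\<^bsub>?G\<^esub>" if "x \<in> carrier ?G" "(\<Sum>k\<in>{1..s}. nat (x k)) = 0" for x
    proof
      fix k
      have "x k = 0" if "k \<in> {1..s}"
        proof -
        have "nat (x k) = 0" using \<open>(\<Sum>k\<in>{1..s}. nat (x k)) = 0\<close> that
          by (subst (asm) sum_eq_0_iff) auto
        moreover have "x k \<in> {0..<int p}" using \<open>x \<in> carrier ?G\<close> that unfolding c by (rule PiE_mem)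
        ultimately show ?thesis by simp
      qed
      then show "x k = \<one>\<^bsub>?G\<^esub> k"
        using \<open>x \<in> carrier ?G\<close> unfolding c by (auto simp: elem_abelian_def PiE_iff extensional_def)
    qed
    then show ?case using one by metis
  next
    case (Suc n)
    show ?case
    proof (intro ballI impI)
      fix x assume x: "x \<in> carrier ?G" and sm: "(\<Sum>k\<in>{1..s}. nat (x k)) = Suc n"
      have "\<exists>k\<in>{1..s}. x k > 0"
      proof (rule ccontr)
        assume "\<not> ?thesis"
        then have "(\<Sum>k\<in>{1..s}. nat (x k)) = 0" by (intro sum.neutral) auto
        then show False using sm by simp
      qed
      then obtain k where k: "k \<in> {1..s}" "x k > 0" by blast
      define y where "y = x(k := x k - 1)"
      have y: "y \<in> carrier ?G"
        using x k unfolding c y_def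
        by (auto simp: PiE_iff extensional_def intro: less_trans[of "x k - 1" "x k"])
      have xy: "x = sigma s k \<otimes>\<^bsub>?G\<^esub> y"
        using x k unfolding c
        by (auto simp: mult_elem_abelian y_def sigma_def PiE_iff extensional_def fun_eq_iff)
      have "(\<Sum>t\<in>{1..s}. nat (x t)) = nat (x k) + (\<Sum>t\<in>{1..s} - {k}. nat (x t))"
        using k by (simp add: sum.remove)
      moreover have "(\<Sum>t\<in>{1..s}. nat (y t)) = nat (y k) + (\<Sum>t\<in>{1..s} - {k}. nat (y t))"
        using k by (simp add: sum.remove)
      moreover have "(\<Sum>t\<in>{1..s} - {k}. nat (y t)) = (\<Sum>t\<in>{1..s} - {k}. nat (x t))"
        by (rule sum.cong) (auto simp: y_def)
      ultimately have "(\<Sum>t\<in>{1..s}. nat (y t)) = n"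
        using sm k by (simp add: y_def)
      then have "\<theta> y = \<eta> y" using Suc y by blast
      then show "\<theta> x = \<eta> x"
        unfolding xy using hm y eq k sigma_carrier[OF p] by simp
    qed
  qed
  then show ?thesis using x by blast
qed

lemma is_alpha_unique:
  assumes p: "p > 1" and a: "is_alpha p s i \<alpha>" and b: "is_alpha p s i \<beta>"
    and x: "x \<in> carrier (elem_abelian p s)" and y: "y \<in> carrier (elem_abelian p s)"
  shows "\<alpha> x y = \<beta> x y"
proof -
  let ?G = "elem_abelian p s"
  note sc = sigma_carrier[OF p]
  have anti: "\<gamma> g h * \<gamma> h g = 1"
    if "alternating_bicharacter ?G \<gamma>" "g \<in> carrier ?G" "h \<in> carrier ?G" for \<gamma> g h
  proof -
    interpret group ?G by (rule group_elem_abelian)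
    have gh: "g \<otimes>\<^bsub>?G\<^esub> h \<in> carrier ?G" using that by simp
    have l: "\<gamma> (g \<otimes>\<^bsub>?G\<^esub> h) k = \<gamma> g k * \<gamma> h k" if "k \<in> carrier ?G" for k
      using hom_mult[of "\<lambda>g. \<gamma> g k" ?G Cstar g h] \<open>g \<in> carrier ?G\<close> \<open>h \<in> carrier ?G\<close> that
        \<open>alternating_bicharacter ?G \<gamma>\<close> by (simp add: alternating_bicharacter_def Cstar_def)
    have r: "\<gamma> k (g \<otimes>\<^bsub>?G\<^esub> h) = \<gamma> k g * \<gamma> k h" if "k \<in> carrier ?G" for k
      using hom_mult[of "\<lambda>g. \<gamma> k g" ?G Cstar g h] \<open>g \<in> carrier ?G\<close> \<open>h \<in> carrier ?G\<close> that
        \<open>alternating_bicharacter ?G \<gamma>\<close> by (simp add: alternating_bicharacter_def Cstar_def)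
    have "\<gamma> k k = 1" if "k \<in> carrier ?G" for k
      using \<open>alternating_bicharacter ?G \<gamma>\<close> that by (simp add: alternating_bicharacter_def)
    then have "\<gamma> (g \<otimes>\<^bsub>?G\<^esub> h) (g \<otimes>\<^bsub>?G\<^esub> h) = 1" "\<gamma> g g = 1" "\<gamma> h h = 1"
      using gh that(2,3) by blast+
    then show ?thesis using l[OF gh] r[OF that(2)] r[OF that(3)] by simp
  qed
  have s: "\<alpha> (sigma s j) (sigma s l) = \<beta> (sigma s j) (sigma s l)"
    if "j \<in> {1..s}" "l \<in> {1..s}" for j l
  proof -
    have lt: "\<alpha> (sigma s j) (sigma s l) = \<beta> (sigma s j) (sigma s l)"
      if "j \<in> {1..s}" "l \<in> {1..s}" "j < l" for j l
      using a b that unfolding is_alpha_def by auto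
    consider "j < l" | "j = l" | "l < j" by linarith
    then show ?thesis
    proof cases
      case 1 then show ?thesis using lt that by blast
    next
      case 2 then show ?thesis
        using a b sc by (auto simp: is_alpha_def alternating_bicharacter_def)
    next
      case 3
      then have "\<alpha> (sigma s l) (sigma s j) = \<beta> (sigma s l) (sigma s j)" using lt that by blast
      moreover have "\<alpha> (sigma s j) (sigma s l) * \<alpha> (sigma s l) (sigma s j) = 1"
        "\<beta> (sigma s j) (sigma s l) * \<beta> (sigma s l) (sigma s j) = 1"
        using a b anti sc by (auto simp: is_alpha_def)
      ultimately show ?thesis by (metis mult_right_cancel mult_zero_right zero_neq_one)
    qed
  qed
  have l: "(\<lambda>h. \<gamma> g h) \<in> hom ?G Cstar" "(\<lambda>h. \<gamma> h g) \<in> hom ?G Cstar"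
    if "is_alpha p s i \<gamma>" "g \<in> carrier ?G" for \<gamma> g
    using that by (auto simp: is_alpha_def alternating_bicharacter_def)
  have "\<alpha> (sigma s j) y = \<beta> (sigma s j) y" if "j \<in> {1..s}" for j
    by (rule hom_determined_by_sigma[OF p l(1)[OF a sc] l(1)[OF b sc]]) (use s that y in auto)
  then show ?thesis
    by (rule hom_determined_by_sigma[OF p l(2)[OF a y] l(2)[OF b y] _ x])
qed

end

(*
  An alternating bicharacter on an elementary abelian p-group has a symplectic basis, hence is
  congruent to some alpha_i. The bicharacter determines the cocycle up to a coboundary, because a
  symmetric cocycle defines an abelian extension by the divisible group C^*, which splits. So every
  twisted group algebra is isometric to the one of the explicit bilinear cocycle
  (a, b) |-> zeta^(a_1 b_(i+1) + ... + a_i b_(2i)), whose irreducible representations are given by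
  clock and shift matrices twisted by characters; orthogonality of characters shows that they
  decompose the algebra into p^(s-2i) matrix blocks of size p^i. The number 2^(p^(s-2i)) of central
  idempotents recovers i from the isomorphism type, so isomorphic algebras share their normal form.
*)

theory Submission
  imports Defs "HOL-Number_Theory.Cong"
begin

section \<open>Symmetric cocycles\<close>

text \<open>All isometries here are monomial maps \<open>u_a |-> l a u_(psi a)\<close>: the
  automorphism from a symplectic basis and the scalars from a coboundary enter together in one step.
  For the explicit cocycle no semisimplicity theory is invoked. The entries of all representations
  are packed into one function on the group, and passing from coefficients to entries becomes a
  Fourier transform whose kernel is a product over coordinates, each factor being a delta or a
  character of C_p. Its inverse can be written down, so bijectivity onto the matrix blocks is a
  computation. The number p^(s-2i) of blocks is the order of the radical of the bicharacter, which
  is the dimension of the centre. Counting central idempotents involves the multiplication alone, so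
  this invariant is preserved by every ring isomorphism. Cocycles are not normalized, whence the
  recurring factor f(1,1).\<close>

lemma comm_group_elem_abelian: "comm_group (elem_abelian p s)"
  by (rule group.group_comm_groupI[OF group_elem_abelian]) (simp add: mult_elem_abelian add.commute)

lemma one_elem_abelian: "\<one>\<^bsub>elem_abelian p s\<^esub> = (\<lambda>k\<in>{1..s}. 0)"
  by (simp add: elem_abelian_def)

lemma card_elem_abelian: "p > 0 \<Longrightarrow> card (carrier (elem_abelian p s)) = p ^ s"
  by (simp add: carrier_elem_abelian card_PiE)

lemma int_pow_elem_abelian:
  assumes x: "x \<in> carrier (elem_abelian p s)"
  shows "x [^]\<^bsub>elem_abelian p s\<^esub> (m::int) = (\<lambda>k\<in>{1..s}. (m * x k) mod int p)"
proof
  interpret group "elem_abelian p s" by (rule group_elem_abelian)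
  fix k
  have c: "x [^]\<^bsub>elem_abelian p s\<^esub> m \<in> carrier (elem_abelian p s)" using x by simp
  show "(x [^]\<^bsub>elem_abelian p s\<^esub> m) k = (\<lambda>k\<in>{1..s}. (m * x k) mod int p) k"
  proof (cases "k \<in> {1..s}")
    case True
    then have "(\<lambda>y. y k) \<in> hom (elem_abelian p s) (integer_mod_group p)"
      by (auto simp: hom_def elem_abelian_def simp del: atLeastAtMost_iff)
    from hom_int_pow[OF this x group_elem_abelian group_integer_mod_group] True
    show ?thesis by (simp add: int_pow_integer_mod_group)
  next
    case False
    then show ?thesis using c by (auto simp: elem_abelian_def PiE_iff extensional_def)
  qed
qed

lemma int_pow_order_elem_abelian:
  assumes "x \<in> carrier (elem_abelian p s)"
  shows "x [^]\<^bsub>elem_abelian p s\<^esub> int p = \<one>\<^bsub>elem_abelian p s\<^esub>"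
  using assms by (simp add: int_pow_elem_abelian one_elem_abelian)

text \<open>Coordinates of a product in \<open>elem_abelian\<close> are reduced mod p; this lets
  them serve as exponents of elements killed by p.\<close>

lemma (in group) int_pow_mod_order:
  assumes x: "x \<in> carrier G" and o: "x [^] int p = \<one>"
  shows "x [^] (m mod int p) = x [^] m"
proof -
  have "x [^] m = x [^] (int p * (m div int p) + m mod int p)" by simp
  also have "\<dots> = (x [^] int p) [^] (m div int p) \<otimes> x [^] (m mod int p)"
    using x by (simp only: int_pow_mult int_pow_pow)
  also have "\<dots> = x [^] (m mod int p)" using x by (simp add: o int_pow_one)
  finally show ?thesis ..
qed

section \<open>Splitting of abelian extensions by the nonzero complex numbers\<close>

lemma complex_root_exists:
  fixes z :: complex
  assumes "z \<noteq> 0" "p > 0"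
  obtains r where "r \<noteq> 0" "r ^ p = z"
proof
  have "exp (Ln z / of_nat p) ^ p = exp (of_nat p * (Ln z / of_nat p))"
    by (simp only: exp_of_nat_mult)
  then show "exp (Ln z / of_nat p) ^ p = z" using assms by simp
qed simp

text \<open>Universal property of (C_p)^n. Only the chosen images have to be killed by p, not all of
  \<open>E\<close>; the extension to which this is applied contains all nonzero scalars and does not
  have exponent p.\<close>

lemma elem_abelian_lift_hom:
  assumes E: "comm_group E" and x: "\<And>j. j \<in> {1..n} \<Longrightarrow> x j \<in> carrier E"
    and o: "\<And>j. j \<in> {1..n} \<Longrightarrow> x j [^]\<^bsub>E\<^esub> int p = \<one>\<^bsub>E\<^esub>"
  shows "(\<lambda>a. finprod E (\<lambda>j. x j [^]\<^bsub>E\<^esub> (a j :: int)) {1..n}) \<in> hom (elem_abelian p n) E"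
proof (rule homI)
  interpret comm_group E by (rule E)
  show cl: "finprod E (\<lambda>j. x j [^]\<^bsub>E\<^esub> (a j :: int)) {1..n} \<in> carrier E" for a
    using x by (auto intro!: finprod_closed)
  fix a b :: "nat \<Rightarrow> int"
  have "finprod E (\<lambda>j. x j [^]\<^bsub>E\<^esub> (a \<otimes>\<^bsub>elem_abelian p n\<^esub> b) j) {1..n}
    = finprod E (\<lambda>j. x j [^]\<^bsub>E\<^esub> a j \<otimes>\<^bsub>E\<^esub> x j [^]\<^bsub>E\<^esub> b j) {1..n}"
  proof (rule finprod_cong')
    fix j assume j: "j \<in> {1..n}"
    then show "x j [^]\<^bsub>E\<^esub> (a \<otimes>\<^bsub>elem_abelian p n\<^esub> b) j = x j [^]\<^bsub>E\<^esub> a j \<otimes>\<^bsub>E\<^esub> x j [^]\<^bsub>E\<^esub> b j"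
      by (simp add: mult_elem_abelian int_pow_mod_order[OF x o] int_pow_mult x)
  qed (use x in auto)
  also have "\<dots> = finprod E (\<lambda>j. x j [^]\<^bsub>E\<^esub> a j) {1..n} \<otimes>\<^bsub>E\<^esub> finprod E (\<lambda>j. x j [^]\<^bsub>E\<^esub> b j) {1..n}"
    using x by (auto intro!: finprod_multf)
  finally show "finprod E (\<lambda>j. x j [^]\<^bsub>E\<^esub> (a \<otimes>\<^bsub>elem_abelian p n\<^esub> b) j) {1..n} = \<dots>" .
qed

text \<open>The pair (c, a) stands for c u_a, so this is the group of nonzero multiples of basis
  elements of the twisted group algebra, with the same unit as the algebra.\<close>

definition central_extension ::
    "('g, 'b) monoid_scheme \<Rightarrow> ('g \<Rightarrow> 'g \<Rightarrow> complex) \<Rightarrow> (complex \<times> 'g) monoid" where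
  "central_extension G q =
    \<lparr>carrier = (- {0}) \<times> carrier G,
     monoid.mult = (\<lambda>(c, a) (d, b). (c * d * q a b, a \<otimes>\<^bsub>G\<^esub> b)),
     one = (inverse (q \<one>\<^bsub>G\<^esub> \<one>\<^bsub>G\<^esub>), \<one>\<^bsub>G\<^esub>)\<rparr>"

text \<open>Associativity is the cocycle identity and commutativity is the symmetry of
  \<open>q\<close>.\<close>

lemma comm_group_central_extension:
  fixes G (structure)
  assumes G: "comm_group G" and q: "q \<in> cocycles2 G"
    and sym: "\<And>a b. a \<in> carrier G \<Longrightarrow> b \<in> carrier G \<Longrightarrow> q a b = q b a"
  shows "comm_group (central_extension G q)"
proof -
  interpret comm_group G by (rule G)
  have nz: "q a b \<noteq> 0" if "a \<in> carrier G" "b \<in> carrier G" for a b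
    using q that by (auto simp: cocycles2_def Cstar_def)
  have coc: "q a b * q (a \<otimes> b) c = q b c * q a (b \<otimes> c)"
    if "a \<in> carrier G" "b \<in> carrier G" "c \<in> carrier G" for a b c
    using q that by (auto simp: cocycles2_def)
  have q1: "q \<one> a = q \<one> \<one>" if "a \<in> carrier G" for a
    by (rule cocycle_one(1)[OF _ q that]) (rule is_group)
  show ?thesis
  proof (rule comm_groupI)
    fix x y z assume xyz: "x \<in> carrier (central_extension G q)" "y \<in> carrier (central_extension G q)"
       "z \<in> carrier (central_extension G q)"
    obtain c a d b e k where [simp]: "x = (c, a)" "y = (d, b)" "z = (e, k)"
      by (metis surj_pair)
    have cl: "a \<in> carrier G" "b \<in> carrier G" "k \<in> carrier G"
      using xyz by (auto simp: central_extension_def)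
    have "c * d * q a b * e * q (a \<otimes> b) k = c * d * e * (q a b * q (a \<otimes> b) k)" by simp
    also have "\<dots> = c * (d * e * q b k) * q a (b \<otimes> k)" using cl by (simp add: coc)
    finally show "x \<otimes>\<^bsub>central_extension G q\<^esub> y \<otimes>\<^bsub>central_extension G q\<^esub> z =
      x \<otimes>\<^bsub>central_extension G q\<^esub> (y \<otimes>\<^bsub>central_extension G q\<^esub> z)"
      using cl by (simp add: central_extension_def m_assoc)
  next
    fix x assume x: "x \<in> carrier (central_extension G q)"
    obtain c a where [simp]: "x = (c, a)" by (metis surj_pair)
    have ca: "c \<noteq> 0" "a \<in> carrier G" using x by (auto simp: central_extension_def)
    show "\<exists>y\<in>carrier (central_extension G q). y \<otimes>\<^bsub>central_extension G q\<^esub> x = \<one>\<^bsub>central_extension G q\<^esub>"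
      by (rule bexI[of _ "(inverse (q \<one> \<one> * c * q (inv a) a), inv a)"])
        (use ca nz in \<open>auto simp: central_extension_def field_simps\<close>)
    show "\<one>\<^bsub>central_extension G q\<^esub> \<otimes>\<^bsub>central_extension G q\<^esub> x = x"
      using ca nz by (simp add: central_extension_def q1[OF ca(2)])
  qed (auto simp: central_extension_def nz sym m_comm)
qed

text \<open>
  The extension of \<open>G\<close> by \<open>\<complex>\<^sup>*\<close> defined by a symmetric cocycle is abelian, and the divisibility of
  \<open>\<complex>\<^sup>*\<close> lets the generators be lifted to elements of order \<open>p\<close>, so the extension splits.
\<close>

lemma symmetric_cocycle_coboundary:
  assumes p: "p > 1" and q: "q \<in> cocycles2 (elem_abelian p s)"
    and sym: "\<And>a b. a \<in> carrier (elem_abelian p s) \<Longrightarrow> b \<in> carrier (elem_abelian p s) \<Longrightarrow> q a b = q b a"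
  obtains l where "\<And>a. a \<in> carrier (elem_abelian p s) \<Longrightarrow> l a \<noteq> 0"
    "\<And>a b. a \<in> carrier (elem_abelian p s) \<Longrightarrow> b \<in> carrier (elem_abelian p s) \<Longrightarrow>
      l a * l b * q a b = l (a \<otimes>\<^bsub>elem_abelian p s\<^esub> b)"
proof -
  let ?G = "elem_abelian p s"
  let ?E = "central_extension ?G q"
  interpret G: comm_group ?G by (rule comm_group_elem_abelian)
  interpret E: comm_group ?E by (rule comm_group_central_extension[OF comm_group_elem_abelian q sym])
  have nz: "q a b \<noteq> 0" if "a \<in> carrier ?G" "b \<in> carrier ?G" for a b
    using q that by (auto simp: cocycles2_def Cstar_def)
  have q1: "q \<one>\<^bsub>?G\<^esub> a = q \<one>\<^bsub>?G\<^esub> \<one>\<^bsub>?G\<^esub>" if "a \<in> carrier ?G" for a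
    by (rule cocycle_one(1)[OF group_elem_abelian q that])
  have n1: "q \<one>\<^bsub>?G\<^esub> \<one>\<^bsub>?G\<^esub> \<noteq> 0" by (simp add: nz)
  have cE: "carrier ?E = (- {0}) \<times> carrier ?G" by (simp add: central_extension_def)
  have snd_hom: "snd \<in> hom ?E ?G" by (auto simp: hom_def central_extension_def)
  \<comment> \<open>The map z |-> (z / q(1,1), 1) embeds the nonzero scalars as a subgroup; the
    division compensates for \<open>q\<close> not being normalized.\<close>
  have scalar_pow: "(z / q \<one>\<^bsub>?G\<^esub> \<one>\<^bsub>?G\<^esub>, \<one>\<^bsub>?G\<^esub>) [^]\<^bsub>?E\<^esub> (m::nat) = (z ^ m / q \<one>\<^bsub>?G\<^esub> \<one>\<^bsub>?G\<^esub>, \<one>\<^bsub>?G\<^esub>)" for z m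
    by (induction m) (use n1 in \<open>auto simp: central_extension_def field_simps\<close>)
  \<comment> \<open>The p-th power of any lift of \<open>a\<close> lies over the unit, so it is a
    scalar, and a p-th root of a scalar corrects the lift to one killed by p.\<close>
  have "\<exists>r. r \<noteq> 0 \<and> (r, a) [^]\<^bsub>?E\<^esub> int p = \<one>\<^bsub>?E\<^esub>" if a: "a \<in> carrier ?G" for a
  proof -
    have 1: "(1, a) \<in> carrier ?E" using a by (simp add: cE)
    have "snd ((1, a) [^]\<^bsub>?E\<^esub> int p) = \<one>\<^bsub>?G\<^esub>"
      using hom_int_pow[OF snd_hom 1 E.is_group G.is_group, of "int p"] a
      by (simp only: int_pow_order_elem_abelian snd_conv)
    moreover have "(1, a) [^]\<^bsub>?E\<^esub> int p \<in> carrier ?E" using 1 by (rule E.int_pow_closed)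
    ultimately obtain c where c: "(1, a) [^]\<^bsub>?E\<^esub> int p = (c, \<one>\<^bsub>?G\<^esub>)" "c \<noteq> 0"
      unfolding cE by (cases "(1, a) [^]\<^bsub>?E\<^esub> int p") auto
    \<comment> \<open>The p-th power of (r, a) works out to (r^p c, 1), and the unit of the
      extension is (1 / q(1,1), 1).\<close>
    obtain r where r: "r \<noteq> 0" "r ^ p = inverse (q \<one>\<^bsub>?G\<^esub> \<one>\<^bsub>?G\<^esub> * c)"
      using complex_root_exists[of "inverse (q \<one>\<^bsub>?G\<^esub> \<one>\<^bsub>?G\<^esub> * c)" p] p c(2) n1 by auto
    have rc: "(r / q \<one>\<^bsub>?G\<^esub> \<one>\<^bsub>?G\<^esub>, \<one>\<^bsub>?G\<^esub>) \<in> carrier ?E" using r n1 by (simp add: cE)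
    have "(r, a) = (r / q \<one>\<^bsub>?G\<^esub> \<one>\<^bsub>?G\<^esub>, \<one>\<^bsub>?G\<^esub>) \<otimes>\<^bsub>?E\<^esub> (1, a)"
      using n1 a by (simp add: central_extension_def q1[OF a])
    then have "(r, a) [^]\<^bsub>?E\<^esub> int p =
        (r / q \<one>\<^bsub>?G\<^esub> \<one>\<^bsub>?G\<^esub>, \<one>\<^bsub>?G\<^esub>) [^]\<^bsub>?E\<^esub> int p \<otimes>\<^bsub>?E\<^esub> (1, a) [^]\<^bsub>?E\<^esub> int p"
      by (simp only: E.int_pow_distrib[OF rc 1])
    also have "\<dots> = \<one>\<^bsub>?E\<^esub>"
      unfolding c unfolding int_pow_int scalar_pow using r(2) c(2) n1
      by (simp add: central_extension_def field_simps)
    finally show ?thesis using r by blast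
  qed
  then obtain r where r: "\<And>a. a \<in> carrier ?G \<Longrightarrow> r a \<noteq> 0"
      "\<And>a. a \<in> carrier ?G \<Longrightarrow> (r a, a) [^]\<^bsub>?E\<^esub> int p = \<one>\<^bsub>?E\<^esub>"
    by metis
  define x where "x j = (r (sigma s j), sigma s j)" for j
  have x: "x j \<in> carrier ?E" "x j [^]\<^bsub>?E\<^esub> int p = \<one>\<^bsub>?E\<^esub>" for j
    using r sigma_carrier[OF p] by (auto simp: x_def cE)
  define \<Phi> where "\<Phi> a = finprod ?E (\<lambda>j. x j [^]\<^bsub>?E\<^esub> (a j :: int)) {1..s}" for a
  have \<Phi>: "\<Phi> \<in> hom ?G ?E" unfolding \<Phi>_def
    by (rule elem_abelian_lift_hom) (use x E.comm_group_axioms in auto)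
  \<comment> \<open>This makes \<open>\<Phi>\<close> a section of the projection. Partial products
    over \<open>J\<close> are tracked so that induction on the index set applies.\<close>
  have "snd (finprod ?E (\<lambda>j. x j [^]\<^bsub>?E\<^esub> (a j :: int)) J) = (\<lambda>k\<in>{1..s}. if k \<in> J then a k else 0)"
    if a: "a \<in> carrier ?G" and J: "finite J" "J \<subseteq> {1..s}" for a J
    using J
  proof (induction J)
    case empty
    have "snd \<one>\<^bsub>?E\<^esub> = \<one>\<^bsub>?G\<^esub>" by (simp add: central_extension_def)
    then show ?case by (simp add: one_elem_abelian)
  next
    case (insert j J)
    have xa: "x j [^]\<^bsub>?E\<^esub> a j \<in> carrier ?E" for j using x by simp
    have sj: "snd (x j [^]\<^bsub>?E\<^esub> a j) = (\<lambda>k\<in>{1..s}. (a j * sigma s j k) mod int p)"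
      using hom_int_pow[OF snd_hom x(1) E.is_group G.is_group] sigma_carrier[OF p]
      by (simp add: x_def int_pow_elem_abelian)
    have "snd (finprod ?E (\<lambda>j. x j [^]\<^bsub>?E\<^esub> a j) (insert j J)) =
      snd (x j [^]\<^bsub>?E\<^esub> a j) \<otimes>\<^bsub>?G\<^esub> snd (finprod ?E (\<lambda>j. x j [^]\<^bsub>?E\<^esub> a j) J)"
      using insert.hyps xa
      by (simp add: hom_mult[OF snd_hom] E.finprod_closed)
    also have "\<dots> = (\<lambda>k\<in>{1..s}. if k \<in> insert j J then a k else 0)"
      unfolding sj using insert a p
      by (auto simp: mult_elem_abelian sigma_def carrier_elem_abelian PiE_iff fun_eq_iff)
    finally show ?case .
  qed
  from this[of _ "{1..s}"] have s: "snd (\<Phi> a) = a" if "a \<in> carrier ?G" for a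
    using that p by (auto simp: \<Phi>_def carrier_elem_abelian PiE_iff extensional_def fun_eq_iff)
  have c: "\<Phi> a \<in> carrier ?E" if "a \<in> carrier ?G" for a
    using \<Phi> that by (auto simp: hom_def)
  \<comment> \<open>The scalar part of a section trivializes the cocycle: compare first components
    in \<open>\<Phi> (a b) = \<Phi> a \<Phi> b\<close>.\<close>
  show thesis
  proof (rule that[of "\<lambda>a. fst (\<Phi> a)"])
    fix a assume a: "a \<in> carrier ?G"
    show "fst (\<Phi> a) \<noteq> 0" using c[OF a] by (auto simp: cE)
    fix b assume b: "b \<in> carrier ?G"
    show "fst (\<Phi> a) * fst (\<Phi> b) * q a b = fst (\<Phi> (a \<otimes>\<^bsub>?G\<^esub> b))"
      using hom_mult[OF \<Phi> a b] s[OF a] s[OF b]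
      by (simp add: central_extension_def case_prod_unfold)
  qed
qed

section \<open>Isometries\<close>

lemma algebra_iso_trans:
  assumes A: "ring A" and f: "f \<in> algebra_iso A B" and g: "g \<in> algebra_iso B C"
  shows "g \<circ> f \<in> algebra_iso A C"
proof -
  have "f \<in> carrier A \<rightarrow> carrier B" using f by (auto simp: algebra_iso_def ring_iso_def bij_betw_def)
  moreover have "g \<circ> f \<in> ring_iso A C"
    using f g by (auto simp: algebra_iso_def intro: ring_iso_set_trans)
  ultimately show ?thesis
    using f g by (auto simp: algebra_iso_def Pi_iff)
qed

lemma algebra_iso_inv:
  assumes A: "ring A" and smult: "\<And>c x. x \<in> carrier A \<Longrightarrow> c \<odot>\<^bsub>A\<^esub> x \<in> carrier A"
    and f: "f \<in> algebra_iso A B"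
  shows "inv_into (carrier A) f \<in> algebra_iso B A"
proof -
  have fr: "f \<in> ring_iso A B" and fs: "f (c \<odot>\<^bsub>A\<^esub> x) = c \<odot>\<^bsub>B\<^esub> f x" if "x \<in> carrier A" for c x
    using f that by (auto simp: algebra_iso_def)
  have bij: "bij_betw f (carrier A) (carrier B)" using f by (auto simp: algebra_iso_def ring_iso_def)
  have "inv_into (carrier A) f (c \<odot>\<^bsub>B\<^esub> y) = c \<odot>\<^bsub>A\<^esub> inv_into (carrier A) f y"
    if y: "y \<in> carrier B" for c y
  proof -
    obtain x where x: "x \<in> carrier A" "y = f x"
      using bij y by (auto simp: bij_betw_def)
    have "c \<odot>\<^bsub>B\<^esub> y = f (c \<odot>\<^bsub>A\<^esub> x)" using x fs by simp
    then show ?thesis using x smult bij by (simp add: bij_betw_def inv_into_f_f)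
  qed
  then show ?thesis
    using ring_iso_set_sym[OF A] f by (auto simp: algebra_iso_def)
qed

lemma twisted_smult_closed:
  "x \<in> carrier (twisted_group_algebra G f) \<Longrightarrow>
    c \<odot>\<^bsub>twisted_group_algebra G f\<^esub> x \<in> carrier (twisted_group_algebra G f)"
  by (simp add: twisted_group_algebra_def)

lemma isometric_imp_isomorphic:
  "isometric G f H f' \<Longrightarrow> algebra_isomorphic (twisted_group_algebra G f) (twisted_group_algebra H f')"
  by (auto simp: isometric_def isometries_def algebra_isomorphic_def)

lemma algebra_isomorphic_trans:
  assumes "ring A" "algebra_isomorphic A B" "algebra_isomorphic B C"
  shows "algebra_isomorphic A C"
  using assms algebra_iso_trans unfolding algebra_isomorphic_def by blast

lemma isometric_trans:
  assumes "ring (twisted_group_algebra G f)" "isometric G f H f'" "isometric H f' K f''"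
  shows "isometric G f K f''"
proof -
  obtain \<phi> \<theta> where \<phi>: "\<phi> \<in> isometries G f H f'" and \<theta>: "\<theta> \<in> isometries H f' K f''"
    using assms by (auto simp: isometric_def)
  have "\<phi> \<in> carrier (twisted_group_algebra G f) \<rightarrow> carrier (twisted_group_algebra H f')"
    using \<phi> by (auto simp: isometries_def algebra_iso_def ring_iso_def bij_betw_def)
  then have "\<theta> \<circ> \<phi> \<in> isometries G f K f''"
    using \<phi> \<theta> algebra_iso_trans[OF assms(1)] by (auto simp: isometries_def Pi_iff)
  then show ?thesis by (auto simp: isometric_def)
qed

lemma isometric_sym:
  assumes A: "ring (twisted_group_algebra G f)" and i: "isometric G f H f'"
  shows "isometric H f' G f"
proof -
  let ?A = "twisted_group_algebra G f" and ?B = "twisted_group_algebra H f'"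
  obtain \<phi> where \<phi>: "\<phi> \<in> isometries G f H f'" using i by (auto simp: isometric_def)
  have bij: "bij_betw \<phi> (carrier ?A) (carrier ?B)"
    using \<phi> by (auto simp: isometries_def algebra_iso_def ring_iso_def)
  let ?\<theta> = "inv_into (carrier ?A) \<phi>"
  have "?\<theta> \<in> algebra_iso ?B ?A"
    using \<phi> by (intro algebra_iso_inv A twisted_smult_closed) (auto simp: isometries_def)
  moreover have "hamming_weight G (?\<theta> y) = hamming_weight H y" if "y \<in> carrier ?B" for y
  proof -
    have "?\<theta> y \<in> carrier ?A" "\<phi> (?\<theta> y) = y"
      using bij_betwE[OF bij_betw_inv_into[OF bij]] bij_betw_inv_into_right[OF bij] that by auto
    then show ?thesis using \<phi> by (auto simp: isometries_def)
  qed
  ultimately show ?thesis by (auto simp: isometric_def isometries_def)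
qed

section \<open>Monomial maps between twisted group algebras\<close>

lemma twisted_mult_apply:
  "(a \<otimes>\<^bsub>twisted_group_algebra G f\<^esub> b) k =
    (\<Sum>g\<in>carrier G. \<Sum>h\<in>carrier G. a g * b h * (f g h * basis_elem (g \<otimes>\<^bsub>G\<^esub> h) k))"
  by (simp add: twisted_group_algebra_def)

lemma sum_basis_elem:
  assumes "finite S" "k \<in> S"
  shows "(\<Sum>m\<in>S. basis_elem k m * F m) = F k"
proof -
  have "(\<Sum>m\<in>S. basis_elem k m * F m) = (\<Sum>m\<in>S. if m = k then F m else 0)"
    by (rule sum.cong) (auto simp: basis_elem_def)
  then show ?thesis using assms by simp
qed

text \<open>Pairing a product with a test function \<open>L\<close> eliminates the deltas of the
  multiplication. Every linear map given by its values on the basis has this shape, so both the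
  monomial maps and the Fourier transform below use it.\<close>

lemma twisted_mult_sum:
  assumes "group G" "finite (carrier G)"
  shows "(\<Sum>k\<in>carrier G. (a \<otimes>\<^bsub>twisted_group_algebra G f\<^esub> b) k * L k) =
    (\<Sum>g\<in>carrier G. \<Sum>h\<in>carrier G. a g * b h * f g h * L (g \<otimes>\<^bsub>G\<^esub> h))"
proof -
  interpret group G by fact
  have "(\<Sum>k\<in>carrier G. (a \<otimes>\<^bsub>twisted_group_algebra G f\<^esub> b) k * L k) =
    (\<Sum>k\<in>carrier G. \<Sum>g\<in>carrier G. \<Sum>h\<in>carrier G.
      basis_elem (g \<otimes>\<^bsub>G\<^esub> h) k * (a g * b h * f g h * L k))"
    by (simp add: twisted_mult_apply sum_distrib_right sum_distrib_left mult_ac)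
  also have "\<dots> = (\<Sum>g\<in>carrier G. \<Sum>h\<in>carrier G. \<Sum>k\<in>carrier G.
      basis_elem (g \<otimes>\<^bsub>G\<^esub> h) k * (a g * b h * f g h * L k))"
    by (rule trans[OF sum.swap], rule sum.cong[OF refl], rule sum.swap)
  also have "\<dots> = (\<Sum>g\<in>carrier G. \<Sum>h\<in>carrier G. a g * b h * f g h * L (g \<otimes>\<^bsub>G\<^esub> h))"
    by (intro sum.cong refl sum_basis_elem assms) auto
  finally show ?thesis .
qed

text \<open>The isometry sends \<open>u_a\<close> to \<open>l a u_(\<psi> a)\<close>, and the last
  hypothesis is its multiplicativity on basis elements. Supports are moved by the bijection
  \<open>\<psi>\<close> and coefficients are scaled by nonzero numbers, which preserves the
  weight.\<close>

lemma isometric_by_basis: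
  assumes G: "group G" "finite (carrier G)" and H: "group H"
    and f: "f \<in> cocycles2 G" and f': "f' \<in> cocycles2 H"
    and \<psi>: "\<psi> \<in> iso G H" and l0: "\<And>a. a \<in> carrier G \<Longrightarrow> l a \<noteq> 0"
    and l: "\<And>a b. a \<in> carrier G \<Longrightarrow> b \<in> carrier G \<Longrightarrow>
      l a * l b * f' (\<psi> a) (\<psi> b) = f a b * l (a \<otimes>\<^bsub>G\<^esub> b)"
  shows "isometric G f H f'"
proof -
  let ?A = "twisted_group_algebra G f" and ?B = "twisted_group_algebra H f'"
  interpret G: group G by fact
  interpret H: group H by fact
  have bij: "bij_betw \<psi> (carrier G) (carrier H)" and hom: "\<psi> \<in> hom G H"
    using \<psi> by (auto simp: iso_def)
  have inj: "\<psi> a = \<psi> b \<longleftrightarrow> a = b" if "a \<in> carrier G" "b \<in> carrier G" for a b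
    using bij that by (auto simp: bij_betw_def inj_on_def)
  have clo: "\<psi> a \<in> carrier H" if "a \<in> carrier G" for a
    using bij that by (auto simp: bij_betw_def)
  have mult: "\<psi> (a \<otimes>\<^bsub>G\<^esub> b) = \<psi> a \<otimes>\<^bsub>H\<^esub> \<psi> b" if "a \<in> carrier G" "b \<in> carrier G" for a b
    using hom that by (auto simp: hom_def)
  have one: "\<psi> \<one>\<^bsub>G\<^esub> = \<one>\<^bsub>H\<^esub>" using hom_one[OF hom G(1) H] .
  have cA: "x \<in> carrier ?A \<longleftrightarrow> (\<forall>g. g \<notin> carrier G \<longrightarrow> x g = 0)" for x
    by (simp add: twisted_group_algebra_def)
  have cB: "x \<in> carrier ?B \<longleftrightarrow> (\<forall>g. g \<notin> carrier H \<longrightarrow> x g = 0)" for x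
    by (simp add: twisted_group_algebra_def)
  define \<Phi> where "\<Phi> x k = (\<Sum>a\<in>carrier G. x a * (l a * basis_elem (\<psi> a) k))" for x k
  have ev: "\<Phi> x (\<psi> a) = l a * x a" if "a \<in> carrier G" for x a
  proof -
    have "\<Phi> x (\<psi> a) = (\<Sum>m\<in>carrier G. basis_elem a m * (l m * x m))"
      unfolding \<Phi>_def by (rule sum.cong) (use inj that in \<open>auto simp: basis_elem_def\<close>)
    then show ?thesis using that G(2) by (simp add: sum_basis_elem)
  qed
  have out: "\<Phi> x k = 0" if "k \<notin> carrier H" for x k
    unfolding \<Phi>_def by (rule sum.neutral) (use clo that in \<open>auto simp: basis_elem_def\<close>)
  have ext: "y = z" if "y \<in> carrier ?B" "z \<in> carrier ?B"
    "\<And>a. a \<in> carrier G \<Longrightarrow> y (\<psi> a) = z (\<psi> a)" for y z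
  proof
    fix k show "y k = z k"
    proof (cases "k \<in> carrier H")
      case True
      then obtain a where "a \<in> carrier G" "k = \<psi> a" using bij by (auto simp: bij_betw_def)
      then show ?thesis using that(3) by simp
    qed (use that in \<open>simp add: cB\<close>)
  qed
  have \<Phi>c: "\<Phi> x \<in> carrier ?B" for x using out by (simp add: cB)
  have \<Phi>mult: "\<Phi> (x \<otimes>\<^bsub>?A\<^esub> y) = \<Phi> x \<otimes>\<^bsub>?B\<^esub> \<Phi> y" for x y
  proof
    fix k
    have "\<Phi> (x \<otimes>\<^bsub>?A\<^esub> y) k = (\<Sum>g\<in>carrier G. \<Sum>h\<in>carrier G. 
        \<Phi> x (\<psi> g) * \<Phi> y (\<psi> h) * (f' (\<psi> g) (\<psi> h) * basis_elem (\<psi> g \<otimes>\<^bsub>H\<^esub> \<psi> h) k))"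
      unfolding \<Phi>_def twisted_mult_sum[OF G]
    proof (intro sum.cong refl)
      fix g h assume gh: "g \<in> carrier G" "h \<in> carrier G"
      have "x g * y h * f g h * (l (g \<otimes>\<^bsub>G\<^esub> h) * basis_elem (\<psi> (g \<otimes>\<^bsub>G\<^esub> h)) k) =
          x g * y h * (f g h * l (g \<otimes>\<^bsub>G\<^esub> h)) * basis_elem (\<psi> (g \<otimes>\<^bsub>G\<^esub> h)) k"
        by simp
      also have "\<dots> = \<Phi> x (\<psi> g) * \<Phi> y (\<psi> h) * (f' (\<psi> g) (\<psi> h) * basis_elem (\<psi> g \<otimes>\<^bsub>H\<^esub> \<psi> h) k)"
        unfolding l[OF gh, symmetric] using gh by (simp add: ev mult)
      finally show "x g * y h * f g h * (l (g \<otimes>\<^bsub>G\<^esub> h) * basis_elem (\<psi> (g \<otimes>\<^bsub>G\<^esub> h)) k) =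
        (\<Sum>a\<in>carrier G. x a * (l a * basis_elem (\<psi> a) (\<psi> g))) *
        (\<Sum>a\<in>carrier G. y a * (l a * basis_elem (\<psi> a) (\<psi> h))) *
        (f' (\<psi> g) (\<psi> h) * basis_elem (\<psi> g \<otimes>\<^bsub>H\<^esub> \<psi> h) k)"
        unfolding \<Phi>_def .
    qed
    also have "\<dots> = (\<Phi> x \<otimes>\<^bsub>?B\<^esub> \<Phi> y) k"
      unfolding twisted_mult_apply
      by (simp add: sum.reindex_bij_betw[OF bij, symmetric])
    finally show "\<Phi> (x \<otimes>\<^bsub>?A\<^esub> y) k = (\<Phi> x \<otimes>\<^bsub>?B\<^esub> \<Phi> y) k" .
  qed
  have \<Phi>one: "\<Phi> \<one>\<^bsub>?A\<^esub> = \<one>\<^bsub>?B\<^esub>"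
  proof (rule ext)
    show "\<one>\<^bsub>?B\<^esub> \<in> carrier ?B" by (auto simp: twisted_group_algebra_def basis_elem_def)
    fix a assume a: "a \<in> carrier G"
    have "f \<one>\<^bsub>G\<^esub> \<one>\<^bsub>G\<^esub> \<noteq> 0" "f' \<one>\<^bsub>H\<^esub> \<one>\<^bsub>H\<^esub> \<noteq> 0"
      using f f' by (auto simp: cocycles2_def Cstar_def)
    \<comment> \<open>The multiplicativity hypothesis at (1, 1) has a factor \<open>l 1\<close> on
      both sides; cancelling it matches the two units.\<close>
    moreover have "l \<one>\<^bsub>G\<^esub> * f' \<one>\<^bsub>H\<^esub> \<one>\<^bsub>H\<^esub> = f \<one>\<^bsub>G\<^esub> \<one>\<^bsub>G\<^esub>"
      using l[of "\<one>\<^bsub>G\<^esub>" "\<one>\<^bsub>G\<^esub>"] l0[of "\<one>\<^bsub>G\<^esub>"] by (simp add: one)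
    ultimately show "\<Phi> \<one>\<^bsub>?A\<^esub> (\<psi> a) = \<one>\<^bsub>?B\<^esub> (\<psi> a)"
      using a one inj[of a "\<one>\<^bsub>G\<^esub>"]
      by (auto simp: ev twisted_group_algebra_def basis_elem_def field_simps)
  qed (rule \<Phi>c)
  have "bij_betw \<Phi> (carrier ?A) (carrier ?B)"
  proof (rule bij_betw_imageI)
    show "inj_on \<Phi> (carrier ?A)"
    proof (rule inj_onI, rule HOL.ext)
      fix x y a assume xy: "x \<in> carrier ?A" "y \<in> carrier ?A" "\<Phi> x = \<Phi> y"
      show "x a = y a"
        using ev[of a x] ev[of a y] l0[of a] xy by (cases "a \<in> carrier G") (auto simp: cA)
    qed
    have "z \<in> \<Phi> ` carrier ?A" if z: "z \<in> carrier ?B" for z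
    proof (rule image_eqI)
      let ?x = "\<lambda>a. if a \<in> carrier G then z (\<psi> a) / l a else 0"
      show "?x \<in> carrier ?A" by (simp add: cA)
      show "z = \<Phi> ?x" by (rule ext[OF z \<Phi>c]) (simp add: ev l0)
    qed
    then show "\<Phi> ` carrier ?A = carrier ?B" using \<Phi>c by auto
  qed
  moreover have "\<Phi> (x \<oplus>\<^bsub>?A\<^esub> y) = \<Phi> x \<oplus>\<^bsub>?B\<^esub> \<Phi> y" for x y
    by (simp add: \<Phi>_def[abs_def] twisted_group_algebra_def algebra_simps sum.distrib)
  moreover have "\<Phi> (c \<odot>\<^bsub>?A\<^esub> x) = c \<odot>\<^bsub>?B\<^esub> \<Phi> x" for c x
    by (simp add: \<Phi>_def[abs_def] twisted_group_algebra_def sum_distrib_left mult_ac)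
  moreover have "hamming_weight H (\<Phi> x) = hamming_weight G x" for x
  proof -
    have "{k \<in> carrier H. \<Phi> x k \<noteq> 0} = \<psi> ` {a \<in> carrier G. x a \<noteq> 0}"
    proof -
      have "carrier H = \<psi> ` carrier G" using bij by (simp add: bij_betw_def)
      then show ?thesis using l0 by (auto simp: ev)
    qed
    moreover have "inj_on \<psi> {a \<in> carrier G. x a \<noteq> 0}" using inj by (auto simp: inj_on_def)
    ultimately show ?thesis by (simp add: hamming_weight_def card_image)
  qed
  ultimately have "\<Phi> \<in> isometries G f H f'"
    using \<Phi>c \<Phi>mult \<Phi>one
    by (auto simp: isometries_def algebra_iso_def ring_iso_def intro!: ring_hom_memI)
  then show ?thesis by (auto simp: isometric_def)
qed

section \<open>The standard cocycle and its representations\<close>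

definition zeta :: "nat \<Rightarrow> complex" where
  "zeta p = exp (2 * complex_of_real pi * \<i> / of_nat p)"

lemma zeta_nonzero [simp]: "zeta p \<noteq> 0"
  by (simp add: zeta_def)

lemma zeta_powi_add: "zeta p powi (m + n) = zeta p powi m * zeta p powi n"
  by (simp add: power_int_add)

lemma zeta_powi_mod: "p > 0 \<Longrightarrow> zeta p powi (m mod int p) = zeta p powi m"
  unfolding zeta_def by (rule root_of_unity_powi_cong) (auto simp: mod_eq_dvd_iff[symmetric])

lemma zeta_powi_eq_1_iff:
  assumes p: "p > 0"
  shows "zeta p powi m = 1 \<longleftrightarrow> int p dvd m"
proof -
  define k where "k = nat (m mod int p)"
  have k: "int k = m mod int p" using p by (simp add: k_def)
  have "zeta p powi m = zeta p powi int k" using p by (simp add: k zeta_powi_mod)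
  also have "\<dots> = exp (2 * complex_of_real pi * \<i> * of_nat k / of_nat p)"
    by (simp add: zeta_def exp_of_nat_mult[symmetric] mult_ac)
  finally have "zeta p powi m = 1 \<longleftrightarrow> p dvd k"
    using complex_root_unity_eq_1[of p k] p by simp
  also have "\<dots> \<longleftrightarrow> int p dvd m"
    by (metis k dvd_mod_iff dvd_refl int_dvd_int_iff)
  finally show ?thesis .
qed

lemma zeta_powi_eq_iff:
  assumes p: "p > 0"
  shows "zeta p powi m = zeta p powi n \<longleftrightarrow> int p dvd m - n"
  using zeta_powi_eq_1_iff[OF p, of "m - n"] by (simp add: power_int_diff)

text \<open>Orthogonality of the characters of Z/p. If p does not divide \<open>d\<close>, this is a
  geometric sum whose ratio differs from 1 and has p-th power 1.\<close>

lemma sum_zeta_powi: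
  assumes p: "p > 0"
  shows "(\<Sum>v\<in>{0..<int p}. zeta p powi (d * v)) = (if int p dvd d then of_nat p else 0)"
proof -
  have "(\<Sum>v\<in>{0..<int p}. zeta p powi (d * v)) = (\<Sum>v\<in>int ` {..<p}. zeta p powi (d * v))"
    by (rule sum.cong) (simp_all add: lessThan_atLeast0 image_int_atLeastLessThan)
  also have "\<dots> = (\<Sum>k<p. (zeta p powi d) ^ k)"
    by (subst sum.reindex) (auto simp: power_int_power')
  finally have *: "(\<Sum>v\<in>{0..<int p}. zeta p powi (d * v)) = (\<Sum>k<p. (zeta p powi d) ^ k)" .
  show ?thesis
  proof (cases "int p dvd d")
    case True
    then have "zeta p powi d = 1" using zeta_powi_eq_1_iff[OF p] by blast
    then show ?thesis using True * by simp
  next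
    case False
    then have 1: "zeta p powi d \<noteq> 1" using zeta_powi_eq_1_iff[OF p] by blast
    have "(zeta p powi d) ^ p = zeta p powi (d * int p)" by (simp only: power_int_power')
    also have "\<dots> = 1" using zeta_powi_eq_1_iff[OF p] by simp
    finally show ?thesis using False 1 * by (simp add: geometric_sum)
  qed
qed

text \<open>Bimultiplicative, hence a cocycle. It keeps one of the two terms of
  \<open>alpha_formula\<close>, so that antisymmetrizing yields \<open>alpha_formula\<close> and not
  its square.\<close>

definition std_cocycle :: "nat \<Rightarrow> nat \<Rightarrow> (nat \<Rightarrow> int) \<Rightarrow> (nat \<Rightarrow> int) \<Rightarrow> complex" where
  "std_cocycle p i a b = (\<Prod>j\<in>{1..i}. zeta p powi (a j * b (j + i)))"

lemma std_cocycle_mult_left: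
  assumes "p > 0" "2 * i \<le> s"
  shows "std_cocycle p i (a \<otimes>\<^bsub>elem_abelian p s\<^esub> b) c = std_cocycle p i a c * std_cocycle p i b c"
  unfolding std_cocycle_def prod.distrib[symmetric]
proof (rule prod.cong[OF refl])
  fix j assume j: "j \<in> {1..i}"
  have "zeta p powi ((a j + b j) mod int p * c (j + i)) = zeta p powi ((a j + b j) * c (j + i))"
    by (subst (1 2) zeta_powi_mod[OF assms(1), symmetric]) (simp add: mod_simps)
  then show "zeta p powi ((a \<otimes>\<^bsub>elem_abelian p s\<^esub> b) j * c (j + i)) =
      zeta p powi (a j * c (j + i)) * zeta p powi (b j * c (j + i))"
    using j assms by (simp add: mult_elem_abelian zeta_powi_add[symmetric] distrib_right)
qed

lemma std_cocycle_mult_right: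
  assumes "p > 0" "2 * i \<le> s"
  shows "std_cocycle p i c (a \<otimes>\<^bsub>elem_abelian p s\<^esub> b) = std_cocycle p i c a * std_cocycle p i c b"
  unfolding std_cocycle_def prod.distrib[symmetric]
proof (rule prod.cong[OF refl])
  fix j assume j: "j \<in> {1..i}"
  have "zeta p powi (c j * ((a (j + i) + b (j + i)) mod int p)) = zeta p powi (c j * (a (j + i) + b (j + i)))"
    by (subst (1 2) zeta_powi_mod[OF assms(1), symmetric]) (simp add: mod_simps)
  then show "zeta p powi (c j * (a \<otimes>\<^bsub>elem_abelian p s\<^esub> b) (j + i)) =
      zeta p powi (c j * a (j + i)) * zeta p powi (c j * b (j + i))"
    using j assms by (simp add: mult_elem_abelian zeta_powi_add[symmetric] distrib_left)
qed

lemma std_cocycle_nonzero: "std_cocycle p i a b \<noteq> 0"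
  by (simp add: std_cocycle_def)

lemma std_cocycle:
  assumes "p > 0" "2 * i \<le> s"
  shows "std_cocycle p i \<in> cocycles2 (elem_abelian p s)"
  by (auto simp: cocycles2_def Cstar_def std_cocycle_mult_left[OF assms] std_cocycle_nonzero
      std_cocycle_mult_right[OF assms])

lemma std_cocycle_bichar:
  "std_cocycle p i a b * inverse (std_cocycle p i b a) = alpha_formula p i a b"
proof -
  have "zeta p powi (\<Sum>j\<in>{1..n}. a j * b (j + i) - a (j + i) * b j) =
    (\<Prod>j\<in>{1..n}. zeta p powi (a j * b (j + i)) * inverse (zeta p powi (b j * a (j + i))))" for n
    by (induction n) (simp_all add: zeta_powi_add power_int_diff divide_inverse mult_ac)
  then show ?thesis
    by (simp add: std_cocycle_def alpha_formula_def zeta_def[symmetric] prod.distrib prod_inversef[unfolded comp_def])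
qed

text \<open>
  In the irreducible representations of the standard algebra the coordinates \<open>i < j \<le> 2i\<close> of a group
  element act as shifts and the others as characters. The matrix coefficients of \<open>u\<^sub>a\<close> are the numbers
  \<open>kern a v\<close>, where the vector \<open>v\<close> packs the label of the representation, the row and the column
  into one group element. In this indexing the kernel is symmetric and a product over coordinates.
\<close>

definition kern :: "nat \<Rightarrow> nat \<Rightarrow> nat \<Rightarrow> (nat \<Rightarrow> int) \<Rightarrow> (nat \<Rightarrow> int) \<Rightarrow> complex" where
  "kern p s i a v = (\<Prod>j\<in>{1..s}. if j \<in> {i<..2*i} then of_bool (a j = v j) else zeta p powi (a j * v j))"

text \<open>The inverse kernel up to the factor \<open>kern_norm\<close>: characters are inverted,
  while a delta is its own inverse.\<close>

definition dual_kern :: "nat \<Rightarrow> nat \<Rightarrow> nat \<Rightarrow> (nat \<Rightarrow> int) \<Rightarrow> (nat \<Rightarrow> int) \<Rightarrow> complex" where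
  "dual_kern p s i a v =
    (\<Prod>j\<in>{1..s}. if j \<in> {i<..2*i} then of_bool (a j = v j) else zeta p powi (- (a j * v j) ))"

lemma kern_commute: "kern p s i a v = kern p s i v a"
  unfolding kern_def by (rule prod.cong) (auto simp: mult.commute)

lemma dual_kern_commute: "dual_kern p s i a v = dual_kern p s i v a"
  unfolding dual_kern_def by (rule prod.cong) (auto simp: mult.commute)

text \<open>One factor p for each coordinate with a character; for 2i \<le> s this is
  p^(s-i).\<close>

definition kern_norm :: "nat \<Rightarrow> nat \<Rightarrow> nat \<Rightarrow> complex" where
  "kern_norm p s i = (\<Prod>j\<in>{1..s}. if j \<in> {i<..2*i} then 1 else of_nat p)"

lemma kern_norm_nonzero: "p > 0 \<Longrightarrow> kern_norm p s i \<noteq> 0"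
  by (auto simp: kern_norm_def)

text \<open>Both kernels are products over coordinates, so the sum over the group factors into one
  sum per coordinate, which is a sum of deltas or an instance of
  \<open>sum_zeta_powi\<close>.\<close>

lemma kern_orthogonal:
  assumes p: "p > 0" and a: "a \<in> carrier (elem_abelian p s)" and b: "b \<in> carrier (elem_abelian p s)"
  shows "(\<Sum>v\<in>carrier (elem_abelian p s). kern p s i a v * dual_kern p s i b v) =
    (if a = b then kern_norm p s i else 0)"
proof -
  have ab: "a j \<in> {0..<int p}" "b j \<in> {0..<int p}" if "j \<in> {1..s}" for j
    using a b p that by (auto simp: carrier_elem_abelian PiE_iff)
  let ?f = "\<lambda>j x. (if j \<in> {i<..2*i} then of_bool (a j = x) else zeta p powi (a j * x)) *
    (if j \<in> {i<..2*i} then of_bool (b j = x) else zeta p powi (- (b j * x)))"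
  have "(\<Sum>v\<in>carrier (elem_abelian p s). kern p s i a v * dual_kern p s i b v) =
    (\<Sum>v\<in>PiE {1..s} (\<lambda>_. {0..<int p}). \<Prod>j\<in>{1..s}. ?f j (v j))"
    using p by (simp add: kern_def dual_kern_def prod.distrib[symmetric] carrier_elem_abelian)
  also have "\<dots> = (\<Prod>j\<in>{1..s}. \<Sum>x\<in>{0..<int p}. ?f j x)"
    by (rule prod_sum_PiE[symmetric]) auto
  also have "\<dots> = (\<Prod>j\<in>{1..s}. if a j = b j then (if j \<in> {i<..2*i} then 1 else of_nat p) else 0)"
  proof (rule prod.cong[OF refl])
    fix j assume j: "j \<in> {1..s}"
    show "(\<Sum>x\<in>{0..<int p}. ?f j x) = (if a j = b j then (if j \<in> {i<..2*i} then 1 else of_nat p) else 0)"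
    proof (cases "j \<in> {i<..2*i}")
      case True
      have "(\<Sum>x\<in>{0..<int p}. ?f j x) = (\<Sum>x\<in>{0..<int p}. if x = a j then of_bool (a j = b j) else 0)"
        by (rule sum.cong) (use True in auto)
      then show ?thesis using True ab[OF j] by simp
    next
      case False
      have "(\<Sum>x\<in>{0..<int p}. ?f j x) = (\<Sum>x\<in>{0..<int p}. zeta p powi ((a j - b j) * x))"
        by (rule sum.cong) (use False in \<open>auto simp: zeta_powi_add[symmetric] algebra_simps\<close>)
      moreover have "int p dvd a j - b j \<longleftrightarrow> a j = b j"
        using ab[OF j] by (simp add: mod_eq_dvd_iff[symmetric])
      ultimately show ?thesis using False by (auto simp: sum_zeta_powi[OF p])
    qed
  qed
  also have "\<dots> = (if a = b then kern_norm p s i else 0)"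
  proof (cases "a = b")
    case False
    then obtain j where "j \<in> {1..s}" "a j \<noteq> b j"
      using a b p by (metis PiE_ext carrier_elem_abelian)
    then have "(\<Prod>j\<in>{1..s}. if a j = b j then (if j \<in> {i<..2*i} then 1 else of_nat p :: complex) else 0) = 0"
      by (intro prod_zero) auto
    then show ?thesis using False by simp
  qed (simp add: kern_norm_def)
  finally show ?thesis .
qed

text \<open>The three blocks play different roles: clock matrices on the first, shifts on the
  second, the central character labelling the representation on the third. The second is reindexed
  by j + i to match \<open>std_cocycle\<close>.\<close>

lemma kern_split:
  assumes "2 * i \<le> s"
  shows "kern p s i a v = of_bool (\<forall>j\<in>{1..i}. a (j + i) = v (j + i)) *
    (\<Prod>j\<in>{1..i}. zeta p powi (a j * v j)) * (\<Prod>j\<in>{2*i<..s}. zeta p powi (a j * v j))"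
proof -
  have "{1..s} = ({1..i} \<union> {i<..2*i}) \<union> {2*i<..s}" using assms by auto
  then have "kern p s i a v =
      (\<Prod>j\<in>{1..i}. if j \<in> {i<..2*i} then of_bool (a j = v j) else zeta p powi (a j * v j)) *
      (\<Prod>j\<in>{i<..2*i}. if j \<in> {i<..2*i} then of_bool (a j = v j) else zeta p powi (a j * v j)) *
      (\<Prod>j\<in>{2*i<..s}. if j \<in> {i<..2*i} then of_bool (a j = v j) else zeta p powi (a j * v j))"
    unfolding kern_def by (subst prod.union_disjoint[symmetric]; (subst prod.union_disjoint[symmetric])?) auto
  also have "(\<Prod>j\<in>{1..i}. if j \<in> {i<..2*i} then of_bool (a j = v j) else zeta p powi (a j * v j)) =
      (\<Prod>j\<in>{1..i}. zeta p powi (a j * v j))" by (rule prod.cong) auto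
  also have "(\<Prod>j\<in>{2*i<..s}. if j \<in> {i<..2*i} then of_bool (a j = v j) else zeta p powi (a j * v j)) =
      (\<Prod>j\<in>{2*i<..s}. zeta p powi (a j * v j))" by (rule prod.cong) auto
  also have "(\<Prod>j\<in>{i<..2*i}. if j \<in> {i<..2*i} then of_bool (a j = v j) else zeta p powi (a j * v j)) =
      (of_bool (\<forall>j\<in>{i<..2*i}. a j = v j) :: complex)"
    by (auto intro!: prod_zero)
  also have "(\<forall>j\<in>{i<..2*i}. a j = v j) \<longleftrightarrow> (\<forall>j\<in>{1..i}. a (j + i) = v (j + i))"
  proof
    assume *: "\<forall>j\<in>{1..i}. a (j + i) = v (j + i)"
    show "\<forall>j\<in>{i<..2*i}. a j = v j"
    proof
      fix j assume "j \<in> {i<..2*i}"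
      then have "j - i \<in> {1..i}" "j - i + i = j" by auto
      then show "a j = v j" using * by metis
    qed
  qed auto
  finally show ?thesis by (simp add: mult_ac)
qed

text \<open>
  The packing \<open>v\<close> for the coefficient at row \<open>x\<close> and column \<open>y\<close> of the representation labelled by \<open>t\<close>.
\<close>

definition coeff_index ::
    "nat \<Rightarrow> nat \<Rightarrow> nat \<Rightarrow> (nat \<Rightarrow> int) \<Rightarrow> (nat \<Rightarrow> int) \<Rightarrow> (nat \<Rightarrow> int) \<Rightarrow> nat \<Rightarrow> int" where
  "coeff_index p s i t x y = (\<lambda>k\<in>{1..s}. if k \<le> i then y k
     else if k \<le> 2 * i then (x (k - i) - y (k - i)) mod int p else t k)"

text \<open>The column is read off the first block, the label off the third, and then the row off
  the differences in the second. Surjectivity is the dimension count p^(s-2i) * p^i * p^i =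
  p^s.\<close>

lemma bij_betw_coeff_index:
  assumes p: "p > 0" and i: "2 * i \<le> s"
  shows "bij_betw (\<lambda>(t, x, y). coeff_index p s i t x y)
    (({2*i<..s} \<rightarrow>\<^sub>E {0..<int p}) \<times> carrier (elem_abelian p i) \<times> carrier (elem_abelian p i))
    (carrier (elem_abelian p s))" (is "bij_betw ?W (?T \<times> ?X \<times> ?X) ?G")
proof -
  have key: "t = t' \<and> x = x' \<and> y = y'"
    if *: "t \<in> ?T" "x \<in> ?X" "y \<in> ?X" "t' \<in> ?T" "x' \<in> ?X" "y' \<in> ?X"
      "coeff_index p s i t x y = coeff_index p s i t' x' y'" for t x y t' x' y'
  proof -
    have eq: "coeff_index p s i t x y k = coeff_index p s i t' x' y' k" for k using * by simp
    note * = *[unfolded carrier_elem_abelian[OF p]]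
    have y: "y = y'"
    proof (rule PiE_ext[OF *(3,6)])
      fix k assume "k \<in> {1..i}" then show "y k = y' k" using eq[of k] i by (simp add: coeff_index_def)
    qed
    have t: "t = t'"
    proof (rule PiE_ext[OF *(1,4)])
      fix k assume "k \<in> {2*i<..s}" then show "t k = t' k" using eq[of k] by (auto simp: coeff_index_def)
    qed
    have x: "x = x'"
    proof (rule PiE_ext[OF *(2,5)])
      fix k assume k: "k \<in> {1..i}"
      then have "(x k - y k) mod int p = (x' k - y k) mod int p"
        using eq[of "k + i"] y i by (auto simp: coeff_index_def)
      then have "x k mod int p = x' k mod int p" by (simp add: mod_eq_dvd_iff)
      moreover have "x k \<in> {0..<int p}" "x' k \<in> {0..<int p}" using *(2,5) k by (auto simp: PiE_iff)
      ultimately show "x k = x' k" by simp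
    qed
    show ?thesis using x y t by simp
  qed
  have inj: "inj_on ?W (?T \<times> ?X \<times> ?X)"
  proof (rule inj_onI)
    fix q q' assume "q \<in> ?T \<times> ?X \<times> ?X" "q' \<in> ?T \<times> ?X \<times> ?X" "?W q = ?W q'"
    then show "q = q'" using key by (cases q; cases q') auto
  qed
  have "?W ` (?T \<times> ?X \<times> ?X) = ?G"
  proof (rule card_subset_eq[OF finite_elem_abelian[OF p]])
    show "?W ` (?T \<times> ?X \<times> ?X) \<subseteq> ?G"
      using p by (auto simp: carrier_elem_abelian coeff_index_def PiE_iff)
    have "card (?W ` (?T \<times> ?X \<times> ?X)) = p ^ (s - 2*i) * (p ^ i * p ^ i)"
      using p by (simp add: card_image[OF inj] card_cartesian_product card_elem_abelian card_PiE)
    also have "\<dots> = p ^ s" using i by (simp add: power_add[symmetric] mult_2[symmetric])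
    finally show "card (?W ` (?T \<times> ?X \<times> ?X)) = card ?G" using p by (simp add: card_elem_abelian)
  qed
  then show ?thesis using inj by (simp add: bij_betw_def)
qed

text \<open>For fixed \<open>t\<close> the matrices with entries
  \<open>kern p s i a (coeff_index p s i t x y)\<close> multiply like the \<open>u_a\<close>. Each
  is monomial, so a single intermediate index \<open>m0\<close> contributes to an entry of the
  product.\<close>

lemma kern_rep_mult:
  assumes p: "p > 0" and i: "2 * i \<le> s"
    and a: "a \<in> carrier (elem_abelian p s)" and b: "b \<in> carrier (elem_abelian p s)"
    and x: "x \<in> carrier (elem_abelian p i)" and y: "y \<in> carrier (elem_abelian p i)"
  shows "(\<Sum>m\<in>carrier (elem_abelian p i).
      kern p s i a (coeff_index p s i t x m) * kern p s i b (coeff_index p s i t m y)) =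
    std_cocycle p i a b * kern p s i (a \<otimes>\<^bsub>elem_abelian p s\<^esub> b) (coeff_index p s i t x y)"
proof -
  let ?X = "carrier (elem_abelian p i)" and ?W = "coeff_index p s i t"
  \<comment> \<open>The shift by \<open>b\<close> sends column \<open>y\<close> to the row
    \<open>m\<close> with m_j - y_j = b_(j+i) mod p.\<close>
  define m0 where "m0 = (\<lambda>j\<in>{1..i}. (y j + b (j + i)) mod int p)"
  have m0: "m0 \<in> ?X" using p by (auto simp: m0_def carrier_elem_abelian)
  have rng: "a j \<in> {0..<int p}" "b j \<in> {0..<int p}" if "j \<in> {1..s}" for j
    using a b p that by (auto simp: carrier_elem_abelian PiE_iff)
  have W: "?W u v j = v j" "?W u v (j + i) = (u j - v j) mod int p" if "j \<in> {1..i}" for u v j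
    using that i by (auto simp: coeff_index_def)
  have W3: "?W u v j = t j" if "j \<in> {2*i<..s}" for u v j
    using that i by (auto simp: coeff_index_def)
  have zero: "kern p s i b (?W m y) = 0" if m: "m \<in> ?X" "m \<noteq> m0" for m
  proof (rule ccontr)
    assume "kern p s i b (?W m y) \<noteq> 0"
    then have *: "b (j + i) = (m j - y j) mod int p" if "j \<in> {1..i}" for j
      using that W by (auto simp: kern_split[OF i])
    have "m = m0"
    proof (rule PiE_ext[OF m(1)[unfolded carrier_elem_abelian[OF p]] m0[unfolded carrier_elem_abelian[OF p]]])
      fix j assume j: "j \<in> {1..i}"
      then have "m j \<in> {0..<int p}" using m p by (auto simp: carrier_elem_abelian PiE_iff)
      then show "m j = m0 j" using j *[OF j] by (simp add: m0_def mod_simps)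
    qed
    then show False using m by simp
  qed
  have "(\<Sum>m\<in>?X. kern p s i a (?W x m) * kern p s i b (?W m y)) =
    (\<Sum>m\<in>?X. if m = m0 then kern p s i a (?W x m0) * kern p s i b (?W m0 y) else 0)"
    by (rule sum.cong) (auto simp: zero)
  also have "\<dots> = kern p s i a (?W x m0) * kern p s i b (?W m0 y)"
    using m0 finite_elem_abelian[OF p] by simp
  also have "\<dots> = std_cocycle p i a b * kern p s i (a \<otimes>\<^bsub>elem_abelian p s\<^esub> b) (?W x y)"
  proof -
    have 1: "(\<forall>j\<in>{1..i}. b (j + i) = ?W m0 y (j + i))"
    proof
      fix j assume j: "j \<in> {1..i}"
      then show "b (j + i) = ?W m0 y (j + i)"
        using rng[of "j + i"] i by (simp add: W m0_def mod_simps)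
    qed
    \<comment> \<open>Shifts add up: x - m0 = x - y - b in the second block.\<close>
    have 2: "(a (j + i) = ?W x m0 (j + i)) = ((a \<otimes>\<^bsub>elem_abelian p s\<^esub> b) (j + i) = ?W x y (j + i))"
      if j: "j \<in> {1..i}" for j
    proof -
      have r: "a (j + i) mod int p = a (j + i)" using rng[of "j + i"] i j by simp
      have "(a (j + i) = ?W x m0 (j + i)) = (a (j + i) mod int p = (x j - (y j + b (j + i))) mod int p)"
        using j r by (simp add: W m0_def mod_simps)
      also have "\<dots> = ((a (j + i) + b (j + i)) mod int p = (x j - y j) mod int p)"
        by (simp add: mod_eq_dvd_iff algebra_simps)
      finally show ?thesis using j i by (simp add: W mult_elem_abelian)
    qed
    \<comment> \<open>The cocycle arises here: the clock part of \<open>a\<close> is evaluated at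
      the shifted index \<open>m0\<close>, and the shift contributes a_j b_(j+i).\<close>
    have 3: "zeta p powi (a j * ?W x m0 j) * zeta p powi (b j * ?W m0 y j) =
      zeta p powi (a j * b (j + i)) * zeta p powi ((a \<otimes>\<^bsub>elem_abelian p s\<^esub> b) j * ?W x y j)"
      if j: "j \<in> {1..i}" for j
    proof -
      have e1: "zeta p powi (a j * ((y j + b (j + i)) mod int p)) = zeta p powi (a j * (y j + b (j + i)))"
        by (subst (1 2) zeta_powi_mod[OF p, symmetric]) (simp add: mod_simps)
      have e2: "zeta p powi ((a j + b j) mod int p * y j) = zeta p powi ((a j + b j) * y j)"
        by (subst (1 2) zeta_powi_mod[OF p, symmetric]) (simp add: mod_simps)
      show ?thesis using j i
        by (simp add: W m0_def mult_elem_abelian e1 e2) (simp add: zeta_powi_add[symmetric] algebra_simps)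
    qed
    have 4: "zeta p powi (a j * ?W x m0 j) * zeta p powi (b j * ?W m0 y j) =
      zeta p powi ((a \<otimes>\<^bsub>elem_abelian p s\<^esub> b) j * ?W x y j)"
      if j: "j \<in> {2*i<..s}" for j
    proof -
      have e2: "zeta p powi ((a j + b j) mod int p * t j) = zeta p powi ((a j + b j) * t j)"
        by (subst (1 2) zeta_powi_mod[OF p, symmetric]) (simp add: mod_simps)
      show ?thesis using j
        by (simp add: W3 mult_elem_abelian e2) (simp add: zeta_powi_add[symmetric] algebra_simps)
    qed
    have "kern p s i a (?W x m0) * kern p s i b (?W m0 y) =
      of_bool (\<forall>j\<in>{1..i}. a (j + i) = ?W x m0 (j + i)) *
      (\<Prod>j\<in>{1..i}. zeta p powi (a j * ?W x m0 j) * zeta p powi (b j * ?W m0 y j)) *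
      (\<Prod>j\<in>{2*i<..s}. zeta p powi (a j * ?W x m0 j) * zeta p powi (b j * ?W m0 y j))"
      unfolding kern_split[OF i] prod.distrib using 1 by simp
    also have "\<dots> = of_bool (\<forall>j\<in>{1..i}. (a \<otimes>\<^bsub>elem_abelian p s\<^esub> b) (j + i) = ?W x y (j + i)) *
      (\<Prod>j\<in>{1..i}. zeta p powi (a j * b (j + i)) * zeta p powi ((a \<otimes>\<^bsub>elem_abelian p s\<^esub> b) j * ?W x y j)) *
      (\<Prod>j\<in>{2*i<..s}. zeta p powi ((a \<otimes>\<^bsub>elem_abelian p s\<^esub> b) j * ?W x y j))"
      by (simp only: 2 3 4 cong: ball_cong prod.cong)
    also have "\<dots> = std_cocycle p i a b * kern p s i (a \<otimes>\<^bsub>elem_abelian p s\<^esub> b) (?W x y)"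
      unfolding kern_split[OF i] prod.distrib std_cocycle_def by (simp only: mult_ac)
    finally show ?thesis .
  qed
  finally show ?thesis .
qed

lemma kern_rep_one:
  assumes p: "p > 0" and i: "2 * i \<le> s"
    and x: "x \<in> carrier (elem_abelian p i)" and y: "y \<in> carrier (elem_abelian p i)"
  shows "kern p s i \<one>\<^bsub>elem_abelian p s\<^esub> (coeff_index p s i t x y) = of_bool (x = y)"
proof -
  have "(\<forall>j\<in>{1..i}. \<one>\<^bsub>elem_abelian p s\<^esub> (j + i) = coeff_index p s i t x y (j + i)) \<longleftrightarrow>
    (\<forall>j\<in>{1..i}. x j = y j)"
  proof (rule ball_cong[OF refl])
    fix j assume j: "j \<in> {1..i}"
    then have "x j \<in> {0..<int p}" "y j \<in> {0..<int p}"
      using x y p by (auto simp: carrier_elem_abelian PiE_iff)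
    then have "(x j - y j) mod int p = 0 \<longleftrightarrow> x j = y j"
      by (simp add: mod_eq_dvd_iff[symmetric] dvd_eq_mod_eq_0[symmetric])
    then show "\<one>\<^bsub>elem_abelian p s\<^esub> (j + i) = coeff_index p s i t x y (j + i) \<longleftrightarrow> x j = y j"
      using j i by (auto simp: one_elem_abelian coeff_index_def)
  qed
  moreover have "(\<forall>j\<in>{1..i}. x j = y j) \<longleftrightarrow> x = y"
    using PiE_ext[OF x[unfolded carrier_elem_abelian[OF p]] y[unfolded carrier_elem_abelian[OF p]]] by auto
  ultimately show ?thesis
    unfolding kern_split[OF i] using i by (simp add: one_elem_abelian)
qed

section \<open>Fourier transform onto the matrix blocks\<close>

lemma matrix_algebra_simps:
  "carrier (matrix_algebra n) = carrier_mat n n"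
  "monoid.mult (matrix_algebra n) = (*)"
  "one (matrix_algebra n) = 1\<^sub>m n"
  "add (matrix_algebra n) = (+)"
  "smult (matrix_algebra n) = (\<cdot>\<^sub>m)"
  by (simp_all add: matrix_algebra_def module_mat_def)

text \<open>The entries of the algebra element \<beta> in all representations at once, with label,
  row and column packed into \<open>v\<close>.\<close>

definition fourier :: "nat \<Rightarrow> nat \<Rightarrow> nat \<Rightarrow> ((nat \<Rightarrow> int) \<Rightarrow> complex) \<Rightarrow> (nat \<Rightarrow> int) \<Rightarrow> complex" where
  "fourier p s i \<beta> v = (\<Sum>a\<in>carrier (elem_abelian p s). \<beta> a * kern p s i a v)"

lemma fourier_inversion:
  assumes p: "p > 0" and b: "b \<in> carrier (elem_abelian p s)"
  shows "(\<Sum>v\<in>carrier (elem_abelian p s). fourier p s i \<beta> v * dual_kern p s i b v) = kern_norm p s i * \<beta> b"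
proof -
  let ?G = "carrier (elem_abelian p s)"
  have "(\<Sum>v\<in>?G. fourier p s i \<beta> v * dual_kern p s i b v) =
    (\<Sum>a\<in>?G. \<beta> a * (\<Sum>v\<in>?G. kern p s i a v * dual_kern p s i b v))"
    unfolding fourier_def sum_distrib_right sum_distrib_left
    by (subst sum.swap) (simp add: mult_ac)
  also have "\<dots> = (\<Sum>a\<in>?G. if a = b then kern_norm p s i * \<beta> b else 0)"
    by (rule sum.cong) (auto simp: kern_orthogonal[OF p _ b])
  also have "\<dots> = kern_norm p s i * \<beta> b"
    using b finite_elem_abelian[OF p] by simp
  finally show ?thesis .
qed

text \<open>The kernels are symmetric in group element and packed index, so the same orthogonality
  relation, with the two roles exchanged, shows that the inverse transform is two-sided.\<close>

lemma fourier_surj: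
  assumes p: "p > 0" and v: "v \<in> carrier (elem_abelian p s)"
  shows "fourier p s i (\<lambda>a. if a \<in> carrier (elem_abelian p s) then
      (\<Sum>u\<in>carrier (elem_abelian p s). N u * dual_kern p s i a u) / kern_norm p s i else 0) v = N v"
proof -
  let ?G = "carrier (elem_abelian p s)"
  have "fourier p s i (\<lambda>a. if a \<in> ?G then
      (\<Sum>u\<in>?G. N u * dual_kern p s i a u) / kern_norm p s i else 0) v =
    (\<Sum>a\<in>?G. (\<Sum>u\<in>?G. N u * dual_kern p s i a u) / kern_norm p s i * kern p s i a v)"
    unfolding fourier_def by (rule sum.cong) auto
  also have "\<dots> = (\<Sum>a\<in>?G. \<Sum>u\<in>?G. N u / kern_norm p s i * (kern p s i v a * dual_kern p s i u a))"
  proof (rule sum.cong[OF refl])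
    fix a
    show "(\<Sum>u\<in>?G. N u * dual_kern p s i a u) / kern_norm p s i * kern p s i a v =
      (\<Sum>u\<in>?G. N u / kern_norm p s i * (kern p s i v a * dual_kern p s i u a))"
      unfolding sum_divide_distrib sum_distrib_right
      by (rule sum.cong) (simp_all add: kern_commute[of p s i a v] dual_kern_commute[of p s i a])
  qed
  also have "\<dots> = (\<Sum>u\<in>?G. N u / kern_norm p s i * (\<Sum>a\<in>?G. kern p s i v a * dual_kern p s i u a))"
    unfolding sum_distrib_left by (rule sum.swap)
  also have "\<dots> = (\<Sum>u\<in>?G. if u = v then N v else 0)"
    by (rule sum.cong) (auto simp: kern_orthogonal[OF p v] kern_norm_nonzero[OF p])
  also have "\<dots> = N v" using v finite_elem_abelian[OF p] by simp
  finally show ?thesis .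
qed

text \<open>The isomorphism is the product of all representations: \<open>kern_rep_mult\<close>
  makes it multiplicative, and \<open>fourier_inversion\<close> and \<open>fourier_surj\<close> make
  it bijective.\<close>

lemma std_twisted_isomorphic_matrix_power:
  assumes p: "p > 0" and i: "2 * i \<le> s"
  shows "algebra_isomorphic (twisted_group_algebra (elem_abelian p s) (std_cocycle p i))
    (algebra_power (matrix_algebra (p ^ i)) (p ^ (s - 2 * i)))"
proof -
  let ?G = "elem_abelian p s" and ?X = "carrier (elem_abelian p i)"
  let ?T = "{2*i<..s} \<rightarrow>\<^sub>E {0..<int p}"
  let ?A = "twisted_group_algebra ?G (std_cocycle p i)"
  let ?B = "algebra_power (matrix_algebra (p ^ i)) (p ^ (s - 2 * i))"
  let ?n = "p ^ i" and ?N = "p ^ (s - 2 * i)"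
  note fin = finite_elem_abelian[OF p]
  have "card ?T = ?N" by (simp add: card_PiE)
  \<comment> \<open>Labels and matrix indices are numbered arbitrarily; only bijectivity of the
    numberings matters.\<close>
  then obtain eT where eT: "bij_betw eT {..<?N} ?T"
    using finite_same_card_bij[of "{..<?N}" ?T] by (auto intro: finite_PiE)
  obtain eX where eX: "bij_betw eX {..<?n} ?X"
    using finite_same_card_bij[of "{..<?n}" ?X] fin card_elem_abelian[OF p] by auto
  define w where "w t r c = coeff_index p s i (eT t) (eX r) (eX c)" for t r c
  have eXc: "eX r \<in> ?X" if "r < ?n" for r using eX that by (auto simp: bij_betw_def)
  have eXi: "eX r = eX c \<longleftrightarrow> r = c" if "r < ?n" "c < ?n" for r c
    using eX that by (auto simp: bij_betw_def inj_on_def)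
  have bij_w: "bij_betw (\<lambda>(t, r, c). w t r c) ({..<?N} \<times> {..<?n} \<times> {..<?n}) (carrier ?G)"
  proof -
    have "bij_betw (map_prod eT (map_prod eX eX)) ({..<?N} \<times> {..<?n} \<times> {..<?n}) (?T \<times> ?X \<times> ?X)"
      by (intro bij_betw_map_prod eT eX)
    from bij_betw_trans[OF this bij_betw_coeff_index[OF p i]] show ?thesis
      by (simp add: comp_def case_prod_unfold w_def)
  qed
  have w: "w t r c \<in> carrier ?G" if "t < ?N" "r < ?n" "c < ?n" for t r c
    using bij_betwE[OF bij_w] that by auto
  let ?F = "fourier p s i"
  define \<Phi> where "\<Phi> \<beta> = (\<lambda>t\<in>{..<?N}. mat ?n ?n (\<lambda>(r, c). ?F \<beta> (w t r c)))" for \<beta>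
  have \<Phi>_closed: "\<Phi> \<beta> \<in> carrier ?B" for \<beta>
    by (auto simp: \<Phi>_def algebra_power_def matrix_algebra_simps)
  have \<Phi>_mult: "\<Phi> (\<beta> \<otimes>\<^bsub>?A\<^esub> \<gamma>) = \<Phi> \<beta> \<otimes>\<^bsub>?B\<^esub> \<Phi> \<gamma>" for \<beta> \<gamma>
  proof
    fix t
    show "\<Phi> (\<beta> \<otimes>\<^bsub>?A\<^esub> \<gamma>) t = (\<Phi> \<beta> \<otimes>\<^bsub>?B\<^esub> \<Phi> \<gamma>) t"
    proof (cases "t < ?N")
      case True
      have "?F (\<beta> \<otimes>\<^bsub>?A\<^esub> \<gamma>) (w t r c) = (\<Sum>m<?n. ?F \<beta> (w t r m) * ?F \<gamma> (w t m c))"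
        if rc: "r < ?n" "c < ?n" for r c
      proof -
        have "?F (\<beta> \<otimes>\<^bsub>?A\<^esub> \<gamma>) (w t r c) = (\<Sum>a\<in>carrier ?G. \<Sum>b\<in>carrier ?G.
            \<beta> a * \<gamma> b * (std_cocycle p i a b * kern p s i (a \<otimes>\<^bsub>?G\<^esub> b) (w t r c)))"
          unfolding fourier_def twisted_mult_sum[OF group_elem_abelian fin] by (simp add: mult_ac)
        also have "\<dots> = (\<Sum>a\<in>carrier ?G. \<Sum>b\<in>carrier ?G.
            \<beta> a * \<gamma> b * (\<Sum>m<?n. kern p s i a (w t r m) * kern p s i b (w t m c)))"
        proof (intro sum.cong refl)
          fix a b assume ab: "a \<in> carrier ?G" "b \<in> carrier ?G"
          have "(\<Sum>m<?n. kern p s i a (w t r m) * kern p s i b (w t m c)) =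
            (\<Sum>x\<in>?X. kern p s i a (coeff_index p s i (eT t) (eX r) x) *
              kern p s i b (coeff_index p s i (eT t) x (eX c)))"
            unfolding w_def by (rule sum.reindex_bij_betw[OF eX])
          also have "\<dots> = std_cocycle p i a b * kern p s i (a \<otimes>\<^bsub>?G\<^esub> b) (w t r c)"
            unfolding w_def using rc by (intro kern_rep_mult[OF p i ab] eXc)
          finally show "\<beta> a * \<gamma> b * (std_cocycle p i a b * kern p s i (a \<otimes>\<^bsub>?G\<^esub> b) (w t r c)) =
            \<beta> a * \<gamma> b * (\<Sum>m<?n. kern p s i a (w t r m) * kern p s i b (w t m c))" by simp
        qed
        also have "\<dots> = (\<Sum>a\<in>carrier ?G. \<Sum>m<?n. \<Sum>b\<in>carrier ?G.
            (\<beta> a * kern p s i a (w t r m)) * (\<gamma> b * kern p s i b (w t m c)))"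
          unfolding sum_distrib_left
          by (rule sum.cong[OF refl], subst sum.swap) (simp add: mult_ac)
        also have "\<dots> = (\<Sum>m<?n. ?F \<beta> (w t r m) * ?F \<gamma> (w t m c))"
          by (subst sum.swap) (simp add: fourier_def sum_product)
        finally show ?thesis .
      qed
      then have "mat ?n ?n (\<lambda>(r, c). ?F (\<beta> \<otimes>\<^bsub>?A\<^esub> \<gamma>) (w t r c)) =
        mat ?n ?n (\<lambda>(r, c). ?F \<beta> (w t r c)) * mat ?n ?n (\<lambda>(r, c). ?F \<gamma> (w t r c))"
        by (intro eq_matI) (simp_all add: scalar_prod_def lessThan_atLeast0)
      then show ?thesis using True by (simp add: \<Phi>_def algebra_power_def matrix_algebra_simps)
    qed (simp add: \<Phi>_def algebra_power_def)
  qed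
  have \<Phi>_one: "\<Phi> \<one>\<^bsub>?A\<^esub> = \<one>\<^bsub>?B\<^esub>"
  proof
    fix t
    show "\<Phi> \<one>\<^bsub>?A\<^esub> t = \<one>\<^bsub>?B\<^esub> t"
    proof (cases "t < ?N")
      case True
      have o: "\<one>\<^bsub>?G\<^esub> \<in> carrier ?G" using group_elem_abelian by (simp add: group.is_monoid)
      \<comment> \<open>The standard cocycle is normalized, so the unit of its algebra is the basis
        element at the neutral element.\<close>
      have "std_cocycle p i \<one>\<^bsub>?G\<^esub> \<one>\<^bsub>?G\<^esub> = 1"
        using i by (simp add: std_cocycle_def one_elem_abelian)
      then have "?F \<one>\<^bsub>?A\<^esub> v = (\<Sum>a\<in>carrier ?G. basis_elem \<one>\<^bsub>?G\<^esub> a * kern p s i a v)" for v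
        by (simp add: fourier_def twisted_group_algebra_def)
      then have "?F \<one>\<^bsub>?A\<^esub> v = kern p s i \<one>\<^bsub>?G\<^esub> v" for v
        using sum_basis_elem[OF fin o] by simp
      then have "mat ?n ?n (\<lambda>(r, c). ?F \<one>\<^bsub>?A\<^esub> (w t r c)) = 1\<^sub>m ?n"
        by (intro eq_matI) (simp_all add: w_def kern_rep_one[OF p i] eXc eXi)
      then show ?thesis using True by (simp add: \<Phi>_def algebra_power_def matrix_algebra_simps)
    qed (simp add: \<Phi>_def algebra_power_def)
  qed
  have \<Phi>_add: "\<Phi> (\<beta> \<oplus>\<^bsub>?A\<^esub> \<gamma>) = \<Phi> \<beta> \<oplus>\<^bsub>?B\<^esub> \<Phi> \<gamma>" for \<beta> \<gamma>
    by (auto simp: \<Phi>_def algebra_power_def matrix_algebra_simps twisted_group_algebra_def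
        fourier_def distrib_right sum.distrib fun_eq_iff intro!: eq_matI)
  have \<Phi>_smult: "\<Phi> (k \<odot>\<^bsub>?A\<^esub> \<beta>) = k \<odot>\<^bsub>?B\<^esub> \<Phi> \<beta>" for k \<beta>
    by (auto simp: \<Phi>_def algebra_power_def matrix_algebra_simps twisted_group_algebra_def
        fourier_def sum_distrib_left mult_ac fun_eq_iff intro!: eq_matI)
  have entry: "\<Phi> \<beta> t $$ (r, c) = ?F \<beta> (w t r c)" if "t < ?N" "r < ?n" "c < ?n" for \<beta> t r c
    using that by (simp add: \<Phi>_def)
  have "bij_betw \<Phi> (carrier ?A) (carrier ?B)"
  proof (rule bij_betw_imageI)
    show "inj_on \<Phi> (carrier ?A)"
    proof (rule inj_onI)
      fix \<beta> \<gamma> assume bc: "\<beta> \<in> carrier ?A" "\<gamma> \<in> carrier ?A" "\<Phi> \<beta> = \<Phi> \<gamma>"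
      have F: "?F \<beta> v = ?F \<gamma> v" if "v \<in> carrier ?G" for v
      proof -
        have "v \<in> (\<lambda>(t, r, c). w t r c) ` ({..<?N} \<times> {..<?n} \<times> {..<?n})"
          using bij_w that by (simp add: bij_betw_def)
        then obtain t r c where "t < ?N" "r < ?n" "c < ?n" "v = w t r c" by auto
        then show ?thesis using entry[of t r c \<beta>] entry[of t r c \<gamma>] bc by simp
      qed
      show "\<beta> = \<gamma>"
      proof
        fix b show "\<beta> b = \<gamma> b"
        proof (cases "b \<in> carrier ?G")
          case True
          have "kern_norm p s i * \<beta> b = kern_norm p s i * \<gamma> b"
            unfolding fourier_inversion[OF p True, symmetric] by (rule sum.cong) (simp_all add: F)
          then show ?thesis by (simp add: kern_norm_nonzero[OF p])
        qed (use bc in \<open>simp add: twisted_group_algebra_def\<close>)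
      qed
    qed
    have "y \<in> \<Phi> ` carrier ?A" if y: "y \<in> carrier ?B" for y
    proof -
      \<comment> \<open>\<open>g\<close> unpacks a group element into label, row and column, which
        turns the family of matrices \<open>y\<close> into a function \<open>N\<close> on the group
        to which the inverse transform applies.\<close>
      define g where "g = inv_into ({..<?N} \<times> {..<?n} \<times> {..<?n}) (\<lambda>(t, r, c). w t r c)"
      have g: "g (w t r c) = (t, r, c)" if "t < ?N" "r < ?n" "c < ?n" for t r c
        using inv_into_f_f[OF bij_betw_imp_inj_on[OF bij_w], of "(t, r, c)"] that by (simp add: g_def)
      define N where "N v = (case g v of (t, r, c) \<Rightarrow> y t $$ (r, c))" for v
      define \<beta> where "\<beta> a = (if a \<in> carrier ?G then
        (\<Sum>u\<in>carrier ?G. N u * dual_kern p s i a u) / kern_norm p s i else 0)" for a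
      have F: "?F \<beta> (w t r c) = y t $$ (r, c)" if "t < ?N" "r < ?n" "c < ?n" for t r c
        using fourier_surj[OF p w[OF that], of i N] g[OF that] by (simp add: N_def \<beta>_def[abs_def])
      have yt: "y t \<in> carrier_mat ?n ?n" if "t < ?N" for t
        using y that by (auto simp: algebra_power_def matrix_algebra_simps)
      have "y = \<Phi> \<beta>"
      proof
        fix t show "y t = \<Phi> \<beta> t"
        proof (cases "t < ?N")
          case True
          then have "dim_row (y t) = ?n" "dim_col (y t) = ?n" using yt[OF True] by auto
          then show ?thesis using True by (intro eq_matI) (simp_all add: \<Phi>_def F)
        next
          case False
          then show ?thesis using y by (auto simp: algebra_power_def \<Phi>_def PiE_iff extensional_def)
        qed
      qed
      moreover have "\<beta> \<in> carrier ?A" by (simp add: \<beta>_def twisted_group_algebra_def)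
      ultimately show ?thesis by blast
    qed
    then show "\<Phi> ` carrier ?A = carrier ?B" using \<Phi>_closed by auto
  qed
  then have "\<Phi> \<in> algebra_iso ?A ?B"
    using \<Phi>_closed \<Phi>_mult \<Phi>_one \<Phi>_add \<Phi>_smult
    by (auto simp: algebra_iso_def ring_iso_def intro!: ring_hom_memI)
  then show ?thesis by (auto simp: algebra_isomorphic_def)
qed

section \<open>Central idempotents\<close>

definition central_idempotents :: "('a, 'b) ring_scheme \<Rightarrow> 'a set" where
  "central_idempotents A =
    {x \<in> carrier A. (\<forall>y\<in>carrier A. x \<otimes>\<^bsub>A\<^esub> y = y \<otimes>\<^bsub>A\<^esub> x) \<and> x \<otimes>\<^bsub>A\<^esub> x = x}"

lemma card_central_idempotents_iso:
  assumes A: "ring A" and \<phi>: "\<phi> \<in> ring_iso A B"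
  shows "card (central_idempotents A) = card (central_idempotents B)"
proof -
  interpret ring A by fact
  have bij: "bij_betw \<phi> (carrier A) (carrier B)"
    and mult: "\<And>x y. x \<in> carrier A \<Longrightarrow> y \<in> carrier A \<Longrightarrow> \<phi> (x \<otimes>\<^bsub>A\<^esub> y) = \<phi> x \<otimes>\<^bsub>B\<^esub> \<phi> y"
    using \<phi> by (auto simp: ring_iso_def dest: ring_hom_mult)
  have inj: "\<phi> x = \<phi> y \<longleftrightarrow> x = y" if "x \<in> carrier A" "y \<in> carrier A" for x y
    using bij that by (auto simp: bij_betw_def inj_on_def)
  have img: "carrier B = \<phi> ` carrier A" using bij by (simp add: bij_betw_def)
  have "\<phi> x \<in> central_idempotents B \<longleftrightarrow> x \<in> central_idempotents A" if "x \<in> carrier A" for x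
    using that by (simp add: central_idempotents_def img mult[symmetric] inj)
  then have "central_idempotents B = \<phi> ` central_idempotents A"
    by (auto simp: central_idempotents_def img)
  moreover have "inj_on \<phi> (central_idempotents A)"
    using inj by (auto simp: inj_on_def central_idempotents_def)
  ultimately show ?thesis by (simp add: card_image)
qed

lemma central_idempotents_algebra_power:
  assumes one: "\<one>\<^bsub>A\<^esub> \<in> carrier A"
  shows "central_idempotents (algebra_power A n) = (\<Pi>\<^sub>E t\<in>{..<n}. central_idempotents A)"
proof (rule Set.set_eqI)
  fix x
  let ?B = "algebra_power A n"
  have "(\<forall>y\<in>carrier ?B. x \<otimes>\<^bsub>?B\<^esub> y = y \<otimes>\<^bsub>?B\<^esub> x) \<longleftrightarrow>
    (\<forall>t<n. \<forall>z\<in>carrier A. x t \<otimes>\<^bsub>A\<^esub> z = z \<otimes>\<^bsub>A\<^esub> x t)" if x: "x \<in> carrier ?B"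
  proof (intro iffI allI impI ballI)
    fix t z assume *: "\<forall>y\<in>carrier ?B. x \<otimes>\<^bsub>?B\<^esub> y = y \<otimes>\<^bsub>?B\<^esub> x" and t: "t < n" and z: "z \<in> carrier A"
    \<comment> \<open>A test element that probes coordinate \<open>t\<close> alone; the ones
      elsewhere merely keep it in the carrier.\<close>
    define y where "y = (\<lambda>u\<in>{..<n}. if u = t then z else \<one>\<^bsub>A\<^esub>)"
    have "y \<in> carrier ?B" using z one by (auto simp: y_def algebra_power_def)
    then have "(x \<otimes>\<^bsub>?B\<^esub> y) t = (y \<otimes>\<^bsub>?B\<^esub> x) t" using * by simp
    then show "x t \<otimes>\<^bsub>A\<^esub> z = z \<otimes>\<^bsub>A\<^esub> x t" using t by (simp add: algebra_power_def y_def)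
  next
    fix y assume "\<forall>t<n. \<forall>z\<in>carrier A. x t \<otimes>\<^bsub>A\<^esub> z = z \<otimes>\<^bsub>A\<^esub> x t" "y \<in> carrier ?B"
    then show "x \<otimes>\<^bsub>?B\<^esub> y = y \<otimes>\<^bsub>?B\<^esub> x"
      by (auto simp: algebra_power_def PiE_iff fun_eq_iff)
  qed
  moreover have "x \<otimes>\<^bsub>?B\<^esub> x = x \<longleftrightarrow> (\<forall>t<n. x t \<otimes>\<^bsub>A\<^esub> x t = x t)" if x: "x \<in> carrier ?B"
    using x by (auto simp: algebra_power_def PiE_iff fun_eq_iff extensional_def)
  moreover have "x \<in> carrier ?B \<longleftrightarrow> x \<in> (\<Pi>\<^sub>E t\<in>{..<n}. carrier A)" by (simp add: algebra_power_def)
  ultimately have "x \<in> central_idempotents ?B \<longleftrightarrow> x \<in> (\<Pi>\<^sub>E t\<in>{..<n}. carrier A) \<and>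
      (\<forall>t<n. \<forall>z\<in>carrier A. x t \<otimes>\<^bsub>A\<^esub> z = z \<otimes>\<^bsub>A\<^esub> x t) \<and> (\<forall>t<n. x t \<otimes>\<^bsub>A\<^esub> x t = x t)"
    unfolding central_idempotents_def mem_Collect_eq by blast
  also have "\<dots> \<longleftrightarrow> x \<in> (\<Pi>\<^sub>E t\<in>{..<n}. central_idempotents A)"
    unfolding central_idempotents_def PiE_iff mem_Collect_eq lessThan_iff by blast
  finally show "x \<in> central_idempotents ?B \<longleftrightarrow> x \<in> (\<Pi>\<^sub>E t\<in>{..<n}. central_idempotents A)" .
qed

text \<open>Commute \<open>M\<close> with matrix units: entry (r, 0) of M E_(c,0) is M_(r,c), while
  entry (r, 0) of E_(c,0) M is M_(0,0) if r = c and 0 otherwise.\<close>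

lemma central_mat_scalar:
  fixes M :: "'a :: comm_ring_1 mat"
  assumes M: "M \<in> carrier_mat n n" and comm: "\<And>E. E \<in> carrier_mat n n \<Longrightarrow> M * E = E * M"
    and n: "n > 0"
  shows "M = (M $$ (0, 0)) \<cdot>\<^sub>m 1\<^sub>m n"
proof -
  define E :: "nat \<Rightarrow> nat \<Rightarrow> 'a mat" where
    "E k l = mat n n (\<lambda>(r, c). if r = k \<and> c = l then 1 else 0)" for k l
  have Ec: "E k l \<in> carrier_mat n n" for k l by (simp add: E_def)
  have L: "(M * E k l) $$ (r, c) = (if c = l then M $$ (r, k) else 0)"
    if "k < n" "l < n" "r < n" "c < n" for k l r c
  proof -
    have "(M * E k l) $$ (r, c) = (\<Sum>m\<in>{0..<n}. M $$ (r, m) * (if m = k \<and> c = l then 1 else 0))"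
      using that M by (simp add: E_def scalar_prod_def)
    also have "\<dots> = (\<Sum>m\<in>{0..<n}. if m = k then (if c = l then M $$ (r, k) else 0) else 0)"
      by (rule sum.cong) auto
    finally show ?thesis using that by simp
  qed
  have R: "(E k l * M) $$ (r, c) = (if r = k then M $$ (l, c) else 0)"
    if "k < n" "l < n" "r < n" "c < n" for k l r c
  proof -
    have "(E k l * M) $$ (r, c) = (\<Sum>m\<in>{0..<n}. (if r = k \<and> m = l then 1 else 0) * M $$ (m, c))"
      using that M by (simp add: E_def scalar_prod_def)
    also have "\<dots> = (\<Sum>m\<in>{0..<n}. if m = l then (if r = k then M $$ (l, c) else 0) else 0)"
      by (rule sum.cong) auto
    finally show ?thesis using that by simp
  qed
  have "M $$ (r, c) = (if r = c then M $$ (0, 0) else 0)" if rc: "r < n" "c < n" for r c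
    using L[of 0 c r c] R[of 0 c r c] L[of c 0 r 0] R[of c 0 r 0] comm[OF Ec] rc n by auto
  then have "M = mat n n (\<lambda>(r, c). if r = c then M $$ (0, 0) else 0)"
    using M by (intro eq_matI) simp_all
  also have "\<dots> = M $$ (0, 0) \<cdot>\<^sub>m 1\<^sub>m n" by (intro eq_matI) auto
  finally show ?thesis .
qed

text \<open>A central matrix is a scalar \<open>a\<close>, and idempotency gives a^2 = a, whose only
  solutions in a field are 0 and 1.\<close>

lemma central_idempotents_matrix_algebra:
  assumes n: "n > 0"
  shows "central_idempotents (matrix_algebra n) = {0\<^sub>m n n, 1\<^sub>m n}"
proof
  show "{0\<^sub>m n n, 1\<^sub>m n} \<subseteq> central_idempotents (matrix_algebra n)"
    by (auto simp: central_idempotents_def matrix_algebra_simps)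
  show "central_idempotents (matrix_algebra n) \<subseteq> {0\<^sub>m n n, 1\<^sub>m n}"
  proof
    fix M assume "M \<in> central_idempotents (matrix_algebra n)"
    then have M: "M \<in> carrier_mat n n" and c: "\<And>E. E \<in> carrier_mat n n \<Longrightarrow> M * E = E * M"
      and sq: "M * M = M"
      by (auto simp: central_idempotents_def matrix_algebra_simps)
    define a where "a = M $$ (0, 0)"
    have Ma: "M = a \<cdot>\<^sub>m 1\<^sub>m n" unfolding a_def by (rule central_mat_scalar[OF M c n])
    have "M * M = M * (a \<cdot>\<^sub>m 1\<^sub>m n)" using Ma by simp
    also have "\<dots> = a \<cdot>\<^sub>m M" using M by (simp add: mult_smult_distrib[OF M one_carrier_mat])
    finally have "M $$ (0, 0) = (a \<cdot>\<^sub>m M) $$ (0, 0)" using sq by simp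
    then have "a = a * a" using M n by (simp add: a_def)
    then have "a = 0 \<or> a = 1" by auto
    then show "M \<in> {0\<^sub>m n n, 1\<^sub>m n}"
    proof
      assume "a = 0"
      then have "M = 0\<^sub>m n n" unfolding Ma by (intro eq_matI) auto
      then show ?thesis by simp
    next
      assume "a = 1"
      then have "M = 1\<^sub>m n" unfolding Ma by (intro eq_matI) auto
      then show ?thesis by simp
    qed
  qed
qed

lemma card_central_idempotents_matrix_power:
  assumes n: "n > 0"
  shows "card (central_idempotents (algebra_power (matrix_algebra n) m)) = 2 ^ m"
proof -
  have "(0\<^sub>m n n :: complex mat) $$ (0, 0) \<noteq> 1\<^sub>m n $$ (0, 0)" using n by simp
  then have "card {0\<^sub>m n n, 1\<^sub>m n :: complex mat} = 2" by (metis card_2_iff)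
  then show ?thesis
    by (simp add: central_idempotents_algebra_power matrix_algebra_simps card_PiE
        central_idempotents_matrix_algebra[OF n])
qed

section \<open>Symplectic bases\<close>

lemma group_Cstar_int_pow: "z \<noteq> 0 \<Longrightarrow> z [^]\<^bsub>Cstar\<^esub> (m::int) = z powi m"
proof -
  assume z: "z \<noteq> 0"
  interpret group Cstar by (rule group_Cstar)
  have n: "z [^]\<^bsub>Cstar\<^esub> (k::nat) = z ^ k" for k
    by (induction k) (simp_all add: Cstar_def)
  have "inv\<^bsub>Cstar\<^esub> (z ^ k) = inverse (z ^ k)" for k
    using z by (intro inv_equality) (auto simp: Cstar_def)
  then show ?thesis
    by (simp add: int_pow_def2 n power_int_def power_inverse)
qed

lemma char_int_pow:
  assumes "group G" "\<xi> \<in> hom G Cstar" "x \<in> carrier G"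
  shows "\<xi> (x [^]\<^bsub>G\<^esub> (m::int)) = \<xi> x powi m"
proof -
  have "\<xi> x \<noteq> 0" using assms by (auto simp: hom_def Cstar_def)
  then show ?thesis
    using hom_int_pow[OF assms(2,3,1) group_Cstar] by (simp add: group_Cstar_int_pow)
qed

lemma char_elem_abelian_value:
  assumes p: "p > 0" and \<xi>: "\<xi> \<in> hom (elem_abelian p s) Cstar" and x: "x \<in> carrier (elem_abelian p s)"
  obtains m where "m \<in> {0..<int p}" "\<xi> x = zeta p powi m"
proof -
  have "\<xi> \<one>\<^bsub>elem_abelian p s\<^esub> = 1"
    using hom_one[OF \<xi> group_elem_abelian group_Cstar] by (simp add: Cstar_def)
  then have "\<xi> x ^ p = 1"
    using char_int_pow[OF group_elem_abelian \<xi> x, of "int p"] int_pow_order_elem_abelian[OF x] by simp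
  then obtain k where k: "k < p" "\<xi> x = exp (2 * complex_of_real pi * \<i> * of_nat k / of_nat p)"
    using complex_roots_unity[of p] p by auto
  then have "\<xi> x = zeta p powi int k"
    by (simp add: zeta_def exp_of_nat_mult[symmetric] mult_ac)
  then show thesis using that[of "int k"] k by simp
qed

text \<open>The value is zeta^k with k not divisible by p. As p is prime, k is invertible mod p, and
  \<open>m\<close> is its inverse.\<close>

lemma char_elem_abelian_normalize:
  assumes p: "prime p" and \<xi>: "\<xi> \<in> hom (elem_abelian p s) Cstar"
    and x: "x \<in> carrier (elem_abelian p s)" and ne: "\<xi> x \<noteq> 1"
  obtains m :: int where "\<xi> (x [^]\<^bsub>elem_abelian p s\<^esub> m) = zeta p"
proof -
  have p0: "p > 0" using p by (rule prime_gt_0_nat)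
  obtain k where k: "\<xi> x = zeta p powi k" using char_elem_abelian_value[OF p0 \<xi> x] by blast
  have "\<not> int p dvd k" using ne zeta_powi_eq_1_iff[OF p0] by (simp add: k)
  moreover have "prime (int p)" using p by simp
  ultimately have "coprime k (int p)" by (metis coprime_commute prime_imp_coprime)
  then obtain m where "[k * m = 1] (mod int p)" using cong_solve_coprime_int by blast
  then have "zeta p powi (k * m) = zeta p powi 1"
    by (subst zeta_powi_eq_iff[OF p0]) (simp add: cong_iff_dvd_diff)
  then have "\<xi> (x [^]\<^bsub>elem_abelian p s\<^esub> m) = zeta p"
    using char_int_pow[OF group_elem_abelian \<xi> x] by (simp add: k power_int_mult)
  then show thesis by (rule that)
qed

section \<open>Splitting off a cyclic factor\<close>

lemma kernel_subgroup:
  assumes H: "subgroup H (elem_abelian p s)" and \<xi>: "\<xi> \<in> hom (elem_abelian p s) Cstar"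
  shows "subgroup {z \<in> H. \<xi> z = 1} (elem_abelian p s)"
proof -
  interpret G: comm_group "elem_abelian p s" by (rule comm_group_elem_abelian)
  interpret H: subgroup H "elem_abelian p s" by fact
  have one: "\<xi> \<one>\<^bsub>elem_abelian p s\<^esub> = 1"
    using hom_one[OF \<xi> group_elem_abelian group_Cstar] by (simp add: Cstar_def)
  have mult: "\<xi> (x \<otimes>\<^bsub>elem_abelian p s\<^esub> y) = \<xi> x * \<xi> y" if "x \<in> H" "y \<in> H" for x y
    using \<xi> that by (auto simp: hom_def Cstar_def)
  show ?thesis
  proof (rule G.subgroupI)
    show "{z \<in> H. \<xi> z = 1} \<noteq> {}" using one H.one_closed by blast
    fix x assume x: "x \<in> {z \<in> H. \<xi> z = 1}"
    then have "\<xi> (inv\<^bsub>elem_abelian p s\<^esub> x) * \<xi> x = 1"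
      using mult[of "inv\<^bsub>elem_abelian p s\<^esub> x" x] one by simp
    then show "inv\<^bsub>elem_abelian p s\<^esub> x \<in> {z \<in> H. \<xi> z = 1}" using x by simp
  qed (use one mult H.one_closed in auto)
qed

text \<open>\<open>H\<close> is the direct product of the kernel of \<open>\<xi>\<close> on
  \<open>H\<close> and the cyclic group of \<open>x\<close>: the value of \<open>\<xi>\<close> at z
  x^m is zeta^m, which determines m in {0..<p} and then z.\<close>

lemma bij_betw_split_off:
  assumes p: "p > 0" and H: "subgroup H (elem_abelian p s)" and \<xi>: "\<xi> \<in> hom (elem_abelian p s) Cstar"
    and x: "x \<in> H" and \<xi>x: "\<xi> x = zeta p"
  shows "bij_betw (\<lambda>(z, m). z \<otimes>\<^bsub>elem_abelian p s\<^esub> x [^]\<^bsub>elem_abelian p s\<^esub> m)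
    ({z \<in> H. \<xi> z = 1} \<times> {0..<int p}) H"
proof -
  let ?G = "elem_abelian p s"
  interpret G: comm_group ?G by (rule comm_group_elem_abelian)
  interpret H: subgroup H ?G by fact
  have xm: "x [^]\<^bsub>?G\<^esub> (m::int) \<in> H" for m
    using G.subgroup_int_pow_closed[OF H x] .
  have mult: "\<xi> (a \<otimes>\<^bsub>?G\<^esub> b) = \<xi> a * \<xi> b" if "a \<in> H" "b \<in> H" for a b
    using \<xi> that by (auto simp: hom_def Cstar_def)
  have val: "\<xi> (z \<otimes>\<^bsub>?G\<^esub> x [^]\<^bsub>?G\<^esub> (m::int)) = \<xi> z * zeta p powi m" if "z \<in> H" for z m
    using that mult xm char_int_pow[OF group_elem_abelian \<xi> H.mem_carrier[OF x]] by (simp add: \<xi>x)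
  show ?thesis
  proof (rule bij_betw_imageI)
    show "inj_on (\<lambda>(z, m). z \<otimes>\<^bsub>?G\<^esub> x [^]\<^bsub>?G\<^esub> m) ({z \<in> H. \<xi> z = 1} \<times> {0..<int p})"
    proof (rule inj_onI)
      fix q q' assume q: "q \<in> {z \<in> H. \<xi> z = 1} \<times> {0..<int p}" "q' \<in> {z \<in> H. \<xi> z = 1} \<times> {0..<int p}"
        and eq: "(\<lambda>(z, m). z \<otimes>\<^bsub>?G\<^esub> x [^]\<^bsub>?G\<^esub> m) q = (\<lambda>(z, m). z \<otimes>\<^bsub>?G\<^esub> x [^]\<^bsub>?G\<^esub> m) q'"
      obtain z m z' m' where zm: "q = (z, m)" "q' = (z', m')" by (metis surj_pair)
      have "zeta p powi m = zeta p powi m'"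
        using val[of z m] val[of z' m'] q eq by (simp add: zm)
      then have "m = m'" using q zm by (simp add: zeta_powi_eq_iff[OF p] mod_eq_dvd_iff[symmetric])
      moreover from this have "z = z'" using eq q zm xm by auto
      ultimately show "q = q'" by (simp add: zm)
    qed
    have "h \<in> (\<lambda>(z, m). z \<otimes>\<^bsub>?G\<^esub> x [^]\<^bsub>?G\<^esub> m) ` ({z \<in> H. \<xi> z = 1} \<times> {0..<int p})" if h: "h \<in> H" for h
    proof -
      obtain m where m: "m \<in> {0..<int p}" "\<xi> h = zeta p powi m"
        using char_elem_abelian_value[OF p \<xi> H.mem_carrier[OF h]] by blast
      define z where "z = h \<otimes>\<^bsub>?G\<^esub> x [^]\<^bsub>?G\<^esub> (- m)"
      have z: "z \<in> H" using h xm by (simp add: z_def)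
      have "\<xi> z = 1" unfolding z_def val[OF h] by (simp add: m power_int_minus)
      moreover have "h = z \<otimes>\<^bsub>?G\<^esub> x [^]\<^bsub>?G\<^esub> m"
        using h x by (simp add: z_def G.m_assoc G.int_pow_mult[symmetric])
      ultimately show ?thesis using z m by force
    qed
    then show "(\<lambda>(z, m). z \<otimes>\<^bsub>?G\<^esub> x [^]\<^bsub>?G\<^esub> m) ` ({z \<in> H. \<xi> z = 1} \<times> {0..<int p}) = H"
      using xm by auto
  qed
qed

text \<open>The map forgetting coordinate \<open>q\<close> and closing the gap. The position matters
  because \<open>alpha_formula\<close> pairs j with j + i, so a new pair has to be inserted between
  existing coordinates.\<close>

definition drop_coord :: "nat \<Rightarrow> nat \<Rightarrow> (nat \<Rightarrow> int) \<Rightarrow> nat \<Rightarrow> int" where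
  "drop_coord n q a = (\<lambda>k\<in>{1..n}. a (if k < q then k else Suc k))"

lemma drop_coord_closed:
  "p > 0 \<Longrightarrow> a \<in> carrier (elem_abelian p (Suc n)) \<Longrightarrow> drop_coord n q a \<in> carrier (elem_abelian p n)"
  by (auto simp: drop_coord_def carrier_elem_abelian PiE_iff)

lemma drop_coord_mult:
  "drop_coord n q (a \<otimes>\<^bsub>elem_abelian p (Suc n)\<^esub> b) =
    drop_coord n q a \<otimes>\<^bsub>elem_abelian p n\<^esub> drop_coord n q b"
  by (auto simp: drop_coord_def mult_elem_abelian fun_eq_iff)

lemma bij_betw_drop_coord:
  assumes p: "p > 0" and q: "q \<in> {1..Suc n}"
  shows "bij_betw (\<lambda>a. (drop_coord n q a, a q)) (carrier (elem_abelian p (Suc n)))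
    (carrier (elem_abelian p n) \<times> {0..<int p})"
proof -
  let ?D = "\<lambda>a. (drop_coord n q a, a q)" and ?G = "carrier (elem_abelian p (Suc n))"
  have inj: "inj_on ?D ?G"
  proof (rule inj_onI)
    fix a b assume ab: "a \<in> ?G" "b \<in> ?G" "?D a = ?D b"
    have eq: "drop_coord n q a k = drop_coord n q b k" for k using ab by simp
    show "a = b"
    proof (rule PiE_ext[OF ab(1,2)[unfolded carrier_elem_abelian[OF p]]])
      fix k assume k: "k \<in> {1..Suc n}"
      consider "k < q" | "k = q" | "k > q" by linarith
      then show "a k = b k"
      proof cases
        case 1 then show ?thesis using eq[of k] k q by (auto simp: drop_coord_def)
      next
        case 2 then show ?thesis using ab by simp
      next
        case 3
        then have "k - 1 \<in> {1..n}" "\<not> k - 1 < q" "Suc (k - 1) = k" using k q by auto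
        then show ?thesis using eq[of "k - 1"] by (simp add: drop_coord_def)
      qed
    qed
  qed
  have "?D ` ?G = carrier (elem_abelian p n) \<times> {0..<int p}"
  proof (rule card_subset_eq)
    have "a q \<in> {0..<int p}" if "a \<in> ?G" for a
      using that q p by (auto simp: carrier_elem_abelian PiE_iff)
    then show "?D ` ?G \<subseteq> carrier (elem_abelian p n) \<times> {0..<int p}"
      using drop_coord_closed[OF p] by auto
    show "card (?D ` ?G) = card (carrier (elem_abelian p n) \<times> {0..<int p})"
      using p by (simp add: card_image[OF inj] card_cartesian_product card_elem_abelian)
  qed (use finite_elem_abelian[OF p] in auto)
  then show ?thesis using inj by (simp add: bij_betw_def)
qed

text \<open>The induction step for parametrizing subgroups: coordinate \<open>q\<close> becomes the
  exponent of \<open>x\<close>, and the remaining coordinates parametrize the kernel of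
  \<open>\<xi>\<close>.\<close>

lemma extend_parametrization:
  assumes p: "p > 0" and q: "q \<in> {1..Suc n}"
    and H: "subgroup H (elem_abelian p s)" and \<xi>: "\<xi> \<in> hom (elem_abelian p s) Cstar"
    and x: "x \<in> H" and \<xi>x: "\<xi> x = zeta p"
    and \<psi>: "\<psi> \<in> hom (elem_abelian p n) (elem_abelian p s)"
    and bij: "bij_betw \<psi> (carrier (elem_abelian p n)) {z \<in> H. \<xi> z = 1}"
  defines "\<phi> \<equiv> \<lambda>a. \<psi> (drop_coord n q a) \<otimes>\<^bsub>elem_abelian p s\<^esub> x [^]\<^bsub>elem_abelian p s\<^esub> a q"
  shows "\<phi> \<in> hom (elem_abelian p (Suc n)) (elem_abelian p s)"
    "bij_betw \<phi> (carrier (elem_abelian p (Suc n))) H"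
proof -
  let ?G = "elem_abelian p s"
  interpret G: comm_group ?G by (rule comm_group_elem_abelian)
  interpret H: subgroup H ?G by fact
  have xc: "x \<in> carrier ?G" using x by (rule H.mem_carrier)
  have \<psi>c: "\<psi> (drop_coord n q a) \<in> carrier ?G" if "a \<in> carrier (elem_abelian p (Suc n))" for a
    using \<psi> drop_coord_closed[OF p that] by (auto simp: hom_def)
  show "\<phi> \<in> hom (elem_abelian p (Suc n)) ?G"
  proof (rule homI)
    fix a b assume a: "a \<in> carrier (elem_abelian p (Suc n))" and b: "b \<in> carrier (elem_abelian p (Suc n))"
    show "\<phi> a \<in> carrier ?G" using \<psi>c[OF a] xc by (simp add: \<phi>_def)
    have "(a \<otimes>\<^bsub>elem_abelian p (Suc n)\<^esub> b) q = (a q + b q) mod int p"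
      using q by (simp add: mult_elem_abelian)
    then have "x [^]\<^bsub>?G\<^esub> (a \<otimes>\<^bsub>elem_abelian p (Suc n)\<^esub> b) q = x [^]\<^bsub>?G\<^esub> a q \<otimes>\<^bsub>?G\<^esub> x [^]\<^bsub>?G\<^esub> b q"
      using xc by (simp add: G.int_pow_mod_order int_pow_order_elem_abelian G.int_pow_mult)
    moreover have "\<psi> (drop_coord n q (a \<otimes>\<^bsub>elem_abelian p (Suc n)\<^esub> b)) =
        \<psi> (drop_coord n q a) \<otimes>\<^bsub>?G\<^esub> \<psi> (drop_coord n q b)"
      unfolding drop_coord_mult by (intro hom_mult[OF \<psi>] drop_coord_closed p a b)
    ultimately show "\<phi> (a \<otimes>\<^bsub>elem_abelian p (Suc n)\<^esub> b) = \<phi> a \<otimes>\<^bsub>?G\<^esub> \<phi> b"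
      using \<psi>c[OF a] \<psi>c[OF b] xc by (simp add: \<phi>_def G.m_ac)
  qed
  have "bij_betw (map_prod \<psi> id) (carrier (elem_abelian p n) \<times> {0..<int p}) ({z \<in> H. \<xi> z = 1} \<times> {0..<int p})"
    by (rule bij_betw_map_prod[OF bij bij_betw_id])
  from bij_betw_trans[OF bij_betw_trans[OF bij_betw_drop_coord[OF p q] this] bij_betw_split_off[OF p H \<xi> x \<xi>x]]
  show "bij_betw \<phi> (carrier (elem_abelian p (Suc n))) H"
    by (simp add: comp_def \<phi>_def)
qed

section \<open>Hyperbolic splitting for an alternating bicharacter\<close>

locale elem_abelian_bichar =
  fixes p s :: nat and \<alpha> :: "(nat \<Rightarrow> int) \<Rightarrow> (nat \<Rightarrow> int) \<Rightarrow> complex"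
  assumes prime_p: "prime p" and bichar: "alternating_bicharacter (elem_abelian p s) \<alpha>"
begin

abbreviation "G \<equiv> elem_abelian p s"

sublocale comm_group G by (rule comm_group_elem_abelian)

lemma p_pos: "p > 0" using prime_p by (rule prime_gt_0_nat)

lemma hom_left: "h \<in> carrier G \<Longrightarrow> (\<lambda>g. \<alpha> g h) \<in> hom G Cstar"
  and hom_right: "g \<in> carrier G \<Longrightarrow> (\<lambda>h. \<alpha> g h) \<in> hom G Cstar"
  and self: "g \<in> carrier G \<Longrightarrow> \<alpha> g g = 1"
  using bichar by (auto simp: alternating_bicharacter_def)

lemma mult_left:
  "\<lbrakk>g \<in> carrier G; h \<in> carrier G; k \<in> carrier G\<rbrakk> \<Longrightarrow> \<alpha> (g \<otimes>\<^bsub>G\<^esub> h) k = \<alpha> g k * \<alpha> h k"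
  using hom_mult[OF hom_left] by (simp add: Cstar_def)

lemma mult_right:
  "\<lbrakk>g \<in> carrier G; h \<in> carrier G; k \<in> carrier G\<rbrakk> \<Longrightarrow> \<alpha> k (g \<otimes>\<^bsub>G\<^esub> h) = \<alpha> k g * \<alpha> k h"
  using hom_mult[OF hom_right] by (simp add: Cstar_def)

lemma pow_left: "\<lbrakk>g \<in> carrier G; k \<in> carrier G\<rbrakk> \<Longrightarrow> \<alpha> (g [^]\<^bsub>G\<^esub> (m::int)) k = \<alpha> g k powi m"
  using char_int_pow[OF group_elem_abelian hom_left] .

lemma pow_right: "\<lbrakk>g \<in> carrier G; k \<in> carrier G\<rbrakk> \<Longrightarrow> \<alpha> k (g [^]\<^bsub>G\<^esub> (m::int)) = \<alpha> k g powi m"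
  using char_int_pow[OF group_elem_abelian hom_right] .

lemma anti:
  assumes "g \<in> carrier G" "h \<in> carrier G"
  shows "\<alpha> h g = inverse (\<alpha> g h)"
proof -
  have gh: "g \<otimes>\<^bsub>G\<^esub> h \<in> carrier G" using assms by simp
  have "\<alpha> (g \<otimes>\<^bsub>G\<^esub> h) (g \<otimes>\<^bsub>G\<^esub> h) = \<alpha> g h * \<alpha> h g"
    unfolding mult_left[OF assms gh] mult_right[OF assms assms(1)] mult_right[OF assms assms(2)]
    using assms by (simp add: self)
  then have "\<alpha> g h * \<alpha> h g = 1" using self[OF gh] by simp
  then show ?thesis by (simp add: inverse_unique)
qed

text \<open>\<open>z\<close> and \<open>z'\<close> are orthogonal to \<open>x\<close> and
  \<open>y\<close>, and \<alpha> is trivial on the diagonal, so only \<alpha> z z' and the cross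
  terms of \<open>x\<close> with \<open>y\<close> survive.\<close>

lemma hyperbolic_expand:
  assumes "z \<in> carrier G" "z' \<in> carrier G" "x \<in> carrier G" "y \<in> carrier G"
    and "\<alpha> x y = zeta p" "\<alpha> z x = 1" "\<alpha> z y = 1" "\<alpha> z' x = 1" "\<alpha> z' y = 1"
  shows "\<alpha> ((z \<otimes>\<^bsub>G\<^esub> y [^]\<^bsub>G\<^esub> l) \<otimes>\<^bsub>G\<^esub> x [^]\<^bsub>G\<^esub> m) ((z' \<otimes>\<^bsub>G\<^esub> y [^]\<^bsub>G\<^esub> l') \<otimes>\<^bsub>G\<^esub> x [^]\<^bsub>G\<^esub> m') =
    \<alpha> z z' * zeta p powi (m * l' - l * m')"
proof -
  have "\<alpha> y x = inverse (zeta p)" "\<alpha> x z' = 1" "\<alpha> y z' = 1"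
    using assms anti[of x y] anti[of z' x] anti[of z' y] by auto
  then show ?thesis
    using assms by (simp add: mult_left mult_right pow_left pow_right self)
      (simp add: power_int_inverse power_int_mult[symmetric] power_int_diff field_simps)
qed

text \<open>
  If \<open>\<alpha>\<close> is nontrivial on \<open>H\<close>, split off a hyperbolic pair and pass to its orthogonal complement in \<open>H\<close>;
  otherwise split off a single element, with complement the kernel of a coordinate character.
\<close>

theorem symplectic_parametrization:
  assumes "subgroup H G"
  shows "\<exists>n i \<psi>. 2 * i \<le> n \<and> \<psi> \<in> hom (elem_abelian p n) G \<and>
    bij_betw \<psi> (carrier (elem_abelian p n)) H \<and>
    (\<forall>a\<in>carrier (elem_abelian p n). \<forall>b\<in>carrier (elem_abelian p n).
      \<alpha> (\<psi> a) (\<psi> b) = alpha_formula p i a b)"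
  using assms
proof (induction "card H" arbitrary: H rule: less_induct)
  case less
  note H = less.prems
  interpret H: subgroup H G by fact
  have finH: "finite H" using H.subset finite_elem_abelian[OF p_pos] by (rule finite_subset)
  have ker: "card {z \<in> K. \<xi> z = 1} < card K" "subgroup {z \<in> K. \<xi> z = 1} G"
    if "subgroup K G" "K \<subseteq> H" "\<xi> \<in> hom G Cstar" "x \<in> K" "\<xi> x = zeta p" for K \<xi> x
  proof -
    have "zeta p \<noteq> 1" using zeta_powi_eq_1_iff[OF p_pos, of 1] prime_p by (auto simp: prime_gt_1_nat)
    then show "card {z \<in> K. \<xi> z = 1} < card K"
    proof (intro psubset_card_mono psubsetI)
      have "x \<notin> {z \<in> K. \<xi> z = 1}" using that(5) \<open>zeta p \<noteq> 1\<close> by simp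
      then show "{z \<in> K. \<xi> z = 1} \<noteq> K" using that(4) by blast
    qed (use finite_subset[OF that(2) finH] in auto)
    show "subgroup {z \<in> K. \<xi> z = 1} G" by (rule kernel_subgroup[OF that(1,3)])
  qed
  consider "\<exists>x\<in>H. \<exists>y\<in>H. \<alpha> x y \<noteq> 1" | "\<forall>x\<in>H. \<forall>y\<in>H. \<alpha> x y = 1" "\<exists>x\<in>H. x \<noteq> \<one>\<^bsub>G\<^esub>" | "H = {\<one>\<^bsub>G\<^esub>}"
    using H.one_closed by blast
  then show ?case
  proof cases
    case 1
    then obtain x0 y where x0: "x0 \<in> H" and y: "y \<in> H" and "\<alpha> x0 y \<noteq> 1" by blast
    \<comment> \<open>A power of \<open>x0\<close> makes the pairing exactly \<open>zeta p\<close>,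
      not just nontrivial.\<close>
    then obtain m :: int where m: "\<alpha> (x0 [^]\<^bsub>G\<^esub> m) y = zeta p"
      using char_elem_abelian_normalize[OF prime_p hom_left[OF H.mem_carrier[OF y]] H.mem_carrier[OF x0]]
      by blast
    define x where "x = x0 [^]\<^bsub>G\<^esub> m"
    have x: "x \<in> H" unfolding x_def by (rule subgroup_int_pow_closed[OF H x0])
    have xy: "\<alpha> x y = zeta p" using m by (simp add: x_def)
    note xc = H.mem_carrier[OF x] and yc = H.mem_carrier[OF y]
    \<comment> \<open>\<open>?H1\<close> is the part of \<open>H\<close> orthogonal to
      \<open>y\<close>; it contains \<open>y\<close> and satisfies H = ?H1 x <x>. Inside it,
      \<open>?H2\<close> is also orthogonal to \<open>x\<close>, and ?H1 = ?H2 x <y>.\<close>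
    let ?H1 = "{z \<in> H. \<alpha> z y = 1}"
    let ?H2 = "{z \<in> ?H1. \<alpha> x z = 1}"
    have H1: "subgroup ?H1 G" "card ?H1 < card H"
      using ker[OF H subset_refl hom_left[OF yc] x xy] by auto
    have y1: "y \<in> ?H1" using y yc by (simp add: self)
    have H2: "subgroup ?H2 G" "card ?H2 < card ?H1"
      using ker[OF H1(1) _ hom_right[OF xc] y1 xy] by auto
    from less.hyps[OF less_trans[OF H2(2) H1(2)] H2(1)]
    obtain n i \<psi> where n: "2 * i \<le> n" and \<psi>: "\<psi> \<in> hom (elem_abelian p n) G"
      "bij_betw \<psi> (carrier (elem_abelian p n)) ?H2"
      and form: "\<And>a b. a \<in> carrier (elem_abelian p n) \<Longrightarrow> b \<in> carrier (elem_abelian p n) \<Longrightarrow>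
        \<alpha> (\<psi> a) (\<psi> b) = alpha_formula p i a b" by blast
    \<comment> \<open>In the final numbering \<open>x\<close> sits at i + 1 and \<open>y\<close> at
      its partner position (i + 1) + (i + 1). Since \<open>y\<close> is inserted first, it goes to
      2i + 1 and is pushed up by one when \<open>x\<close> is inserted below it.\<close>
    have "2 * i + 1 \<in> {1..Suc n}" "i + 1 \<in> {1..Suc (Suc n)}" using n by auto
    note E1 = extend_parametrization[OF p_pos this(1) H1(1) hom_right[OF xc] y1 xy \<psi>]
    note E2 = extend_parametrization[OF p_pos \<open>i + 1 \<in> {1..Suc (Suc n)}\<close> H hom_left[OF yc] x xy E1]
    let ?d = "\<lambda>a. drop_coord n (2 * i + 1) (drop_coord (Suc n) (i + 1) a)"
    have d: "?d a \<in> carrier (elem_abelian p n)" if "a \<in> carrier (elem_abelian p (Suc (Suc n)))" for a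
      using drop_coord_closed[OF p_pos] that by blast
    let ?\<phi> = "\<lambda>a. (\<psi> (?d a) \<otimes>\<^bsub>G\<^esub> y [^]\<^bsub>G\<^esub> (drop_coord (Suc n) (i + 1) a (2 * i + 1))) \<otimes>\<^bsub>G\<^esub> x [^]\<^bsub>G\<^esub> a (i + 1)"
    have "\<alpha> (?\<phi> a) (?\<phi> b) = alpha_formula p (Suc i) a b"
      if ab: "a \<in> carrier (elem_abelian p (Suc (Suc n)))" "b \<in> carrier (elem_abelian p (Suc (Suc n)))" for a b
    proof -
      have \<psi>H: "\<psi> (?d a) \<in> ?H2" "\<psi> (?d b) \<in> ?H2" using bij_betwE[OF \<psi>(2)] d ab by blast+
      then have orth: "\<psi> (?d a) \<in> carrier G" "\<psi> (?d b) \<in> carrier G" "\<alpha> (\<psi> (?d a)) x = 1" "\<alpha> (\<psi> (?d b)) x = 1"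
        "\<alpha> (\<psi> (?d a)) y = 1" "\<alpha> (\<psi> (?d b)) y = 1"
        using anti[OF xc H.mem_carrier] by auto
      have last: "drop_coord (Suc n) (i + 1) c (2 * i + 1) = c (2 * i + 2)" for c
        using n by (simp add: drop_coord_def)
      have dj: "?d c j = c j" "?d c (j + i) = c (j + Suc i)" if "j \<in> {1..i}" for c j
        using that n by (auto simp: drop_coord_def)
      have "\<alpha> (?\<phi> a) (?\<phi> b) = alpha_formula p i (?d a) (?d b) *
          zeta p powi (a (i + 1) * b (2 * i + 2) - a (2 * i + 2) * b (i + 1))"
        unfolding last using hyperbolic_expand[OF orth(1,2) xc yc xy orth(3,5,4,6)] form d ab by simp
      also have "\<dots> = zeta p powi ((\<Sum>j\<in>{1..i}. a j * b (j + Suc i) - a (j + Suc i) * b j) +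
          (a (i + 1) * b (2 * i + 2) - a (2 * i + 2) * b (i + 1)))"
      proof -
        have "(\<Sum>j\<in>{1..i}. ?d a j * ?d b (j + i) - ?d a (j + i) * ?d b j) =
          (\<Sum>j\<in>{1..i}. a j * b (j + Suc i) - a (j + Suc i) * b j)"
          by (rule sum.cong[OF refl]) (simp only: dj)
        then show ?thesis by (simp add: alpha_formula_def zeta_def[symmetric] zeta_powi_add)
      qed
      also have "\<dots> = alpha_formula p (Suc i) a b"
        unfolding alpha_formula_def zeta_def[symmetric] by (simp add: mult_2)
      finally show ?thesis .
    qed
    then show ?thesis using E2 n by (intro exI[of _ "Suc (Suc n)"] exI[of _ "Suc i"] exI[of _ ?\<phi>]) auto
  next
    case 2
    then obtain x0 where x0: "x0 \<in> H" "x0 \<noteq> \<one>\<^bsub>G\<^esub>" by blast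
    have c: "carrier G = {1..s} \<rightarrow>\<^sub>E {0..<int p}" by (rule carrier_elem_abelian[OF p_pos])
    have "\<exists>k\<in>{1..s}. x0 k \<noteq> 0"
    proof (rule ccontr)
      assume *: "\<not> (\<exists>k\<in>{1..s}. x0 k \<noteq> 0)"
      have "x0 = \<one>\<^bsub>G\<^esub>"
      proof (rule PiE_ext[OF H.mem_carrier[OF x0(1), unfolded c] one_closed[unfolded c]])
        fix k assume "k \<in> {1..s}"
        then show "x0 k = \<one>\<^bsub>G\<^esub> k" using * by (simp add: one_elem_abelian)
      qed
      then show False using x0 by simp
    qed
    then obtain k where k: "k \<in> {1..s}" "x0 k \<noteq> 0" by blast
    \<comment> \<open>Here \<alpha> yields no nontrivial character on \<open>H\<close>, so a
      coordinate at which \<open>x0\<close> is nonzero supplies one.\<close>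
    define \<xi> where "\<xi> z = zeta p powi (z k)" for z :: "nat \<Rightarrow> int"
    have \<xi>: "\<xi> \<in> hom G Cstar"
      using k by (auto simp: hom_def Cstar_def \<xi>_def mult_elem_abelian zeta_powi_mod[OF p_pos] zeta_powi_add)
    have "\<not> int p dvd x0 k"
    proof -
      have "x0 k \<in> {0..<int p}" using H.mem_carrier[OF x0(1)] k(1) unfolding c by (rule PiE_mem)
      then show ?thesis using k(2) zdvd_not_zless[of "x0 k" "int p"] by simp
    qed
    then have "\<xi> x0 \<noteq> 1" by (simp add: \<xi>_def zeta_powi_eq_1_iff[OF p_pos])
    then obtain m :: int where m: "\<xi> (x0 [^]\<^bsub>G\<^esub> m) = zeta p"
      using char_elem_abelian_normalize[OF prime_p \<xi> H.mem_carrier[OF x0(1)]] by blast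
    have x: "x0 [^]\<^bsub>G\<^esub> m \<in> H" by (rule subgroup_int_pow_closed[OF H x0(1)])
    from less.hyps[OF ker[OF H subset_refl \<xi> x m]]
    obtain n i \<psi> where n: "2 * i \<le> n" and \<psi>: "\<psi> \<in> hom (elem_abelian p n) G"
      "bij_betw \<psi> (carrier (elem_abelian p n)) {z \<in> H. \<xi> z = 1}"
      and form: "\<And>a b. a \<in> carrier (elem_abelian p n) \<Longrightarrow> b \<in> carrier (elem_abelian p n) \<Longrightarrow>
        \<alpha> (\<psi> a) (\<psi> b) = alpha_formula p i a b" by blast
    \<comment> \<open>Appending at the end leaves the first 2i coordinates, which are all that
      \<open>alpha_formula\<close> reads, in place.\<close>
    have "Suc n \<in> {1..Suc n}" by simp
    note E = extend_parametrization[OF p_pos this H \<xi> x m \<psi>]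
    let ?\<phi> = "\<lambda>a. \<psi> (drop_coord n (Suc n) a) \<otimes>\<^bsub>G\<^esub> (x0 [^]\<^bsub>G\<^esub> m) [^]\<^bsub>G\<^esub> a (Suc n)"
    have "\<alpha> (?\<phi> a) (?\<phi> b) = alpha_formula p i a b"
      if ab: "a \<in> carrier (elem_abelian p (Suc n))" "b \<in> carrier (elem_abelian p (Suc n))" for a b
    proof -
      let ?d = "drop_coord n (Suc n)"
      have d: "?d a \<in> carrier (elem_abelian p n)" "?d b \<in> carrier (elem_abelian p n)"
        using drop_coord_closed[OF p_pos] ab by auto
      \<comment> \<open>Since \<alpha> is trivial on \<open>H\<close>, the new pairing equals the
        one on the smaller subgroup, so the formula carries over with the same i, whatever it
        is.\<close>
      have "\<alpha> (?\<phi> a) (?\<phi> b) = 1" using bij_betwE[OF E(2)] ab 2(1) by blast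
      also have "1 = \<alpha> (\<psi> (?d a)) (\<psi> (?d b))" using bij_betwE[OF \<psi>(2)] d 2(1) by force
      also have "\<dots> = alpha_formula p i (?d a) (?d b)" by (rule form[OF d])
      also have "\<dots> = alpha_formula p i a b"
      proof -
        have "(\<Sum>j\<in>{1..i}. ?d a j * ?d b (j + i) - ?d a (j + i) * ?d b j) =
          (\<Sum>j\<in>{1..i}. a j * b (j + i) - a (j + i) * b j)"
          by (rule sum.cong[OF refl]) (use n in \<open>auto simp: drop_coord_def\<close>)
        then show ?thesis by (simp add: alpha_formula_def)
      qed
      finally show ?thesis .
    qed
    then show ?thesis using E n by (intro exI[of _ "Suc n"] exI[of _ i] exI[of _ ?\<phi>]) auto
  next
    case 3
    have "carrier (elem_abelian p 0) = {\<lambda>_. undefined}" using p_pos by (simp add: carrier_elem_abelian)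
    then show ?thesis
      by (intro exI[of _ 0] exI[of _ "\<lambda>_. \<one>\<^bsub>G\<^esub>"])
        (auto simp: 3 hom_def bij_betw_def alpha_formula_def self)
  qed
qed

text \<open>For the whole group, comparing orders gives p^n = p^s, so the parametrization is an
  automorphism.\<close>

corollary symplectic_iso:
  obtains i \<psi> where "i \<le> s div 2" "\<psi> \<in> iso G G"
    "\<And>a b. a \<in> carrier G \<Longrightarrow> b \<in> carrier G \<Longrightarrow> \<alpha> (\<psi> a) (\<psi> b) = alpha_formula p i a b"
proof -
  obtain n i \<psi> where n: "2 * i \<le> n" and \<psi>: "\<psi> \<in> hom (elem_abelian p n) G"
      "bij_betw \<psi> (carrier (elem_abelian p n)) (carrier G)"
      and form: "\<And>a b. a \<in> carrier (elem_abelian p n) \<Longrightarrow> b \<in> carrier (elem_abelian p n) \<Longrightarrow>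
        \<alpha> (\<psi> a) (\<psi> b) = alpha_formula p i a b"
    using symplectic_parametrization[OF subgroup_self] by blast
  have "p ^ n = p ^ s"
    using bij_betw_same_card[OF \<psi>(2)] p_pos by (simp add: card_elem_abelian)
  then have "n = s" using prime_gt_1_nat[OF prime_p] by simp
  then show thesis using that[of i \<psi>] n \<psi> form by (auto simp: iso_def)
qed

end

section \<open>Normal form\<close>

text \<open>Multiplicativity in the first argument combines the cocycle identities at (g, h, k), (k,
  g, h) and (g, k, h), using commutativity of the group, and cancels the common factor f(g, h) f(gk,
  h). The second argument follows by inversion.\<close>

lemma bichar_of_cocycle_alternating:
  assumes G: "comm_group G" and f: "f \<in> cocycles2 G"
  shows "alternating_bicharacter G (bichar_of_cocycle f)"
proof -
  interpret comm_group G by fact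
  have nz: "f g h \<noteq> 0" if "g \<in> carrier G" "h \<in> carrier G" for g h
    using f that by (auto simp: cocycles2_def Cstar_def)
  have coc: "f g h * f (g \<otimes>\<^bsub>G\<^esub> h) k = f h k * f g (h \<otimes>\<^bsub>G\<^esub> k)"
    if "g \<in> carrier G" "h \<in> carrier G" "k \<in> carrier G" for g h k
    using f that by (auto simp: cocycles2_def)
  have mult: "bichar_of_cocycle f (g \<otimes>\<^bsub>G\<^esub> h) k = bichar_of_cocycle f g k * bichar_of_cocycle f h k"
    if c: "g \<in> carrier G" "h \<in> carrier G" "k \<in> carrier G" for g h k
  proof -
    have cl: "g \<otimes>\<^bsub>G\<^esub> h \<in> carrier G" "h \<otimes>\<^bsub>G\<^esub> k \<in> carrier G" "g \<otimes>\<^bsub>G\<^esub> k \<in> carrier G" using c by auto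
    have 1: "f g h * f (g \<otimes>\<^bsub>G\<^esub> h) k = f h k * f g (h \<otimes>\<^bsub>G\<^esub> k)"
      using coc c by blast
    have 2: "f k g * f (g \<otimes>\<^bsub>G\<^esub> k) h = f g h * f k (g \<otimes>\<^bsub>G\<^esub> h)"
      using coc[OF c(3,1,2)] c by (simp add: m_comm)
    have 3: "f g k * f (g \<otimes>\<^bsub>G\<^esub> k) h = f k h * f g (h \<otimes>\<^bsub>G\<^esub> k)"
      using coc[OF c(1,3,2)] c by (simp add: m_comm)
    have "f g h * f (g \<otimes>\<^bsub>G\<^esub> k) h * (f (g \<otimes>\<^bsub>G\<^esub> h) k * (f k g * f k h)) =
      (f g h * f (g \<otimes>\<^bsub>G\<^esub> h) k) * (f k g * f (g \<otimes>\<^bsub>G\<^esub> k) h) * f k h" by (simp add: mult_ac)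
    also have "\<dots> = f g h * f k (g \<otimes>\<^bsub>G\<^esub> h) * f h k * (f k h * f g (h \<otimes>\<^bsub>G\<^esub> k))"
      by (simp only: 1 2) (simp add: mult_ac)
    also have "\<dots> = f g h * f (g \<otimes>\<^bsub>G\<^esub> k) h * (f k (g \<otimes>\<^bsub>G\<^esub> h) * (f g k * f h k))"
      by (simp only: 3[symmetric]) (simp add: mult_ac)
    finally have "f (g \<otimes>\<^bsub>G\<^esub> h) k * (f k g * f k h) = f k (g \<otimes>\<^bsub>G\<^esub> h) * (f g k * f h k)"
      using nz c cl by simp
    then show ?thesis using nz c cl by (simp add: bichar_of_cocycle_def field_simps)
  qed
  have inv: "bichar_of_cocycle f k g = inverse (bichar_of_cocycle f g k)" for g k
    by (simp add: bichar_of_cocycle_def)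
  have mult': "bichar_of_cocycle f k (g \<otimes>\<^bsub>G\<^esub> h) = bichar_of_cocycle f k g * bichar_of_cocycle f k h"
    if c: "g \<in> carrier G" "h \<in> carrier G" "k \<in> carrier G" for g h k
    unfolding inv[of k] mult[OF c] by simp
  show ?thesis
    unfolding alternating_bicharacter_def
    using nz by (auto simp: hom_def Cstar_def mult mult' ) (auto simp: bichar_of_cocycle_def)
qed

lemma isometric_normal_form:
  assumes p: "p > 1" and i: "2 * i \<le> s" and f: "f \<in> cocycles2 (elem_abelian p s)"
    and \<psi>: "\<psi> \<in> iso (elem_abelian p s) (elem_abelian p s)"
    and form: "\<And>a b. a \<in> carrier (elem_abelian p s) \<Longrightarrow> b \<in> carrier (elem_abelian p s) \<Longrightarrow>
      bichar_of_cocycle f (\<psi> a) (\<psi> b) = alpha_formula p i a b"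
  shows "isometric (elem_abelian p s) (std_cocycle p i) (elem_abelian p s) f"
proof -
  let ?G = "elem_abelian p s"
  interpret comm_group ?G by (rule comm_group_elem_abelian)
  have p0: "p > 0" using p by simp
  have \<psi>c: "\<psi> a \<in> carrier ?G" and \<psi>m: "\<psi> (a \<otimes>\<^bsub>?G\<^esub> b) = \<psi> a \<otimes>\<^bsub>?G\<^esub> \<psi> b"
    if "a \<in> carrier ?G" "b \<in> carrier ?G" for a b
    using \<psi> that by (auto simp: iso_def hom_def)
  note \<psi>c = \<psi>c[OF _ one_closed]
  have nz: "f g h \<noteq> 0" if "g \<in> carrier ?G" "h \<in> carrier ?G" for g h
    using f that by (auto simp: cocycles2_def Cstar_def)
  have coc: "f g h * f (g \<otimes>\<^bsub>?G\<^esub> h) k = f h k * f g (h \<otimes>\<^bsub>?G\<^esub> k)"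
    if "g \<in> carrier ?G" "h \<in> carrier ?G" "k \<in> carrier ?G" for g h k
    using f that by (auto simp: cocycles2_def)
  \<comment> \<open>After pulling \<open>f\<close> back along \<open>\<psi>\<close>, both cocycles
    have the bicharacter \<open>alpha_formula\<close>, so it cancels in the quotient and
    \<open>q\<close> is symmetric.\<close>
  define q where "q a b = f (\<psi> a) (\<psi> b) / std_cocycle p i a b" for a b
  have q: "q \<in> cocycles2 ?G"
    unfolding cocycles2_def
  proof (intro CollectI conjI ballI)
    fix g h k assume c: "g \<in> carrier ?G" "h \<in> carrier ?G" "k \<in> carrier ?G"
    have "f (\<psi> g) (\<psi> h) * f (\<psi> (g \<otimes>\<^bsub>?G\<^esub> h)) (\<psi> k) = f (\<psi> h) (\<psi> k) * f (\<psi> g) (\<psi> (h \<otimes>\<^bsub>?G\<^esub> k))"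
      using coc[OF \<psi>c[OF c(1)] \<psi>c[OF c(2)] \<psi>c[OF c(3)]] c by (simp add: \<psi>m)
    moreover have "std_cocycle p i g h * std_cocycle p i (g \<otimes>\<^bsub>?G\<^esub> h) k =
        std_cocycle p i h k * std_cocycle p i g (h \<otimes>\<^bsub>?G\<^esub> k)"
      using std_cocycle[OF p0 i] c by (auto simp: cocycles2_def)
    ultimately show "q g h * q (g \<otimes>\<^bsub>?G\<^esub> h) k = q h k * q g (h \<otimes>\<^bsub>?G\<^esub> k)"
      by (simp add: q_def)
  qed (use nz \<psi>c in \<open>auto simp: Cstar_def q_def std_cocycle_nonzero\<close>)
  have sym: "q a b = q b a" if "a \<in> carrier ?G" "b \<in> carrier ?G" for a b
    using form[OF that] nz[OF \<psi>c[OF that(1)] \<psi>c[OF that(2)]] nz[OF \<psi>c[OF that(2)] \<psi>c[OF that(1)]]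
    unfolding std_cocycle_bichar[symmetric]
    by (simp add: bichar_of_cocycle_def q_def std_cocycle_nonzero field_simps)
  show ?thesis
  proof (rule symmetric_cocycle_coboundary[OF p q sym])
    fix l assume l0: "\<And>a. a \<in> carrier ?G \<Longrightarrow> l a \<noteq> 0"
      and l: "\<And>a b. a \<in> carrier ?G \<Longrightarrow> b \<in> carrier ?G \<Longrightarrow> l a * l b * q a b = l (a \<otimes>\<^bsub>?G\<^esub> b)"
    show ?thesis
    proof (rule isometric_by_basis[OF group_elem_abelian finite_elem_abelian[OF p0] group_elem_abelian
          std_cocycle[OF p0 i] f \<psi> l0])
      fix a b assume ab: "a \<in> carrier ?G" "b \<in> carrier ?G"
      show "l a * l b * f (\<psi> a) (\<psi> b) = std_cocycle p i a b * l (a \<otimes>\<^bsub>?G\<^esub> b)"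
        unfolding l[OF ab, symmetric] by (simp add: q_def std_cocycle_nonzero)
    qed
  qed
qed

lemma twisted_isomorphic_matrix_power:
  assumes p: "p > 1" and i: "2 * i \<le> s" and f: "f \<in> cocycles2 (elem_abelian p s)"
    and std: "isometric (elem_abelian p s) (std_cocycle p i) (elem_abelian p s) f"
  shows "algebra_isomorphic (twisted_group_algebra (elem_abelian p s) f)
    (algebra_power (matrix_algebra (p ^ i)) (p ^ (s - 2 * i)))"
proof -
  let ?G = "elem_abelian p s"
  have p0: "p > 0" using p by simp
  have ring: "ring (twisted_group_algebra ?G g)" if "g \<in> cocycles2 ?G" for g
    using twisted_group_algebra_ring[OF group_elem_abelian finite_elem_abelian[OF p0] that] .
  have "isometric ?G f ?G (std_cocycle p i)"
    by (rule isometric_sym[OF ring[OF std_cocycle[OF p0 i]] std])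
  from isometric_imp_isomorphic[OF this] std_twisted_isomorphic_matrix_power[OF p0 i]
  show ?thesis by (rule algebra_isomorphic_trans[OF ring[OF f]])
qed

text \<open>For the second claim no congruence with a standard bicharacter is given;
  \<open>symplectic_iso\<close> supplies one.\<close>

lemma isometric_normal_form_exists:
  assumes p: "prime p" and f: "f \<in> cocycles2 (elem_abelian p s)"
  obtains i where "2 * i \<le> s" "isometric (elem_abelian p s) (std_cocycle p i) (elem_abelian p s) f"
proof -
  interpret elem_abelian_bichar p s "bichar_of_cocycle f"
    by unfold_locales (rule p, rule bichar_of_cocycle_alternating[OF comm_group_elem_abelian f])
  show thesis
  proof (rule symplectic_iso)
    fix i \<psi> assume i: "i \<le> s div 2" and \<psi>: "\<psi> \<in> iso G G"
      and form: "\<And>a b. a \<in> carrier G \<Longrightarrow> b \<in> carrier G \<Longrightarrow>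
        bichar_of_cocycle f (\<psi> a) (\<psi> b) = alpha_formula p i a b"
    have i2: "2 * i \<le> s" using i by linarith
    show thesis
      by (rule that[OF i2 isometric_normal_form[OF prime_gt_1_nat[OF p] i2 f \<psi> form]])
  qed
qed

theorem theorem3p7:
  fixes p s :: nat
  assumes "prime p" and "s > 0"
  shows "(\<forall>f \<in> cocycles2 (elem_abelian p s). \<forall>i \<le> s div 2.
            bichar_congruent (elem_abelian p s) (bichar_of_cocycle f) (alpha p s i) \<longrightarrow>
            algebra_isomorphic (twisted_group_algebra (elem_abelian p s) f)
              (algebra_power (matrix_algebra (p ^ i)) (p ^ (s - 2 * i)))) \<and>
         (\<forall>f1 \<in> cocycles2 (elem_abelian p s). \<forall>f2 \<in> cocycles2 (elem_abelian p s).
            isometric (elem_abelian p s) f1 (elem_abelian p s) f2 \<longleftrightarrow>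
            algebra_isomorphic (twisted_group_algebra (elem_abelian p s) f1)
              (twisted_group_algebra (elem_abelian p s) f2))"
proof (intro conjI ballI allI impI iffI)
  let ?G = "elem_abelian p s"
  have p1: "p > 1" and p0: "p > 0" using prime_gt_1_nat[OF assms(1)] by simp_all
  have ring: "ring (twisted_group_algebra ?G g)" if "g \<in> cocycles2 ?G" for g
    using twisted_group_algebra_ring[OF group_elem_abelian finite_elem_abelian[OF p0] that] .
  {
    fix f i assume f: "f \<in> cocycles2 ?G" and i: "i \<le> s div 2"
      and "bichar_congruent ?G (bichar_of_cocycle f) (alpha p s i)"
    then obtain \<psi> where \<psi>: "\<psi> \<in> iso ?G ?G"
      and eq: "\<And>g h. g \<in> carrier ?G \<Longrightarrow> h \<in> carrier ?G \<Longrightarrow>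
        alpha p s i g h = bichar_of_cocycle f (\<psi> g) (\<psi> h)"
      by (auto simp: bichar_congruent_def)
    have i2: "2 * i \<le> s" using i by linarith
    \<comment> \<open>\<open>alpha\<close> comes from a choice operator, but uniqueness on the
      carrier identifies it there with the explicit formula.\<close>
    have "bichar_of_cocycle f (\<psi> g) (\<psi> h) = alpha_formula p i g h"
      if "g \<in> carrier ?G" "h \<in> carrier ?G" for g h
      using is_alpha_unique[OF p1 is_alpha_alpha[OF p1 i] alpha_formula_is_alpha[OF p1 i] that]
      by (simp add: eq[OF that])
    from twisted_isomorphic_matrix_power[OF p1 i2 f isometric_normal_form[OF p1 i2 f \<psi> this]]
    show "algebra_isomorphic (twisted_group_algebra ?G f)
      (algebra_power (matrix_algebra (p ^ i)) (p ^ (s - 2 * i)))" .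
  }
  fix f1 f2 assume f1: "f1 \<in> cocycles2 ?G" and f2: "f2 \<in> cocycles2 ?G"
  {
    assume "isometric ?G f1 ?G f2"
    then show "algebra_isomorphic (twisted_group_algebra ?G f1) (twisted_group_algebra ?G f2)"
      by (rule isometric_imp_isomorphic)
  }
  assume iso12: "algebra_isomorphic (twisted_group_algebra ?G f1) (twisted_group_algebra ?G f2)"
  obtain i1 where i1: "2 * i1 \<le> s" and n1: "isometric ?G (std_cocycle p i1) ?G f1"
    using isometric_normal_form_exists[OF assms(1) f1] .
  obtain i2 where i2: "2 * i2 \<le> s" and n2: "isometric ?G (std_cocycle p i2) ?G f2"
    using isometric_normal_form_exists[OF assms(1) f2] .
  have count: "card (central_idempotents (twisted_group_algebra ?G f)) = 2 ^ (p ^ (s - 2 * i))"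
    if c: "2 * i \<le> s" "f \<in> cocycles2 ?G" "isometric ?G (std_cocycle p i) ?G f" for f i
  proof -
    obtain \<phi> where "\<phi> \<in> ring_iso (twisted_group_algebra ?G f)
        (algebra_power (matrix_algebra (p ^ i)) (p ^ (s - 2 * i)))"
      using twisted_isomorphic_matrix_power[OF p1 c]
      by (auto simp: algebra_isomorphic_def algebra_iso_def)
    from card_central_idempotents_iso[OF ring[OF c(2)] this] show ?thesis
      using p0 by (simp add: card_central_idempotents_matrix_power)
  qed
  obtain \<phi> where "\<phi> \<in> ring_iso (twisted_group_algebra ?G f1) (twisted_group_algebra ?G f2)"
    using iso12 by (auto simp: algebra_isomorphic_def algebra_iso_def)
  from card_central_idempotents_iso[OF ring[OF f1] this]
  have "p ^ (s - 2 * i1) = p ^ (s - 2 * i2)"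
    by (simp add: count[OF i1 f1 n1] count[OF i2 f2 n2])
  \<comment> \<open>Comparing the counts has removed the base 2, and p > 1 now removes the base p.
    The bounds 2i \<le> s keep the natural subtraction from truncating, so i itself is
    recovered.\<close>
  then have "s - 2 * i1 = s - 2 * i2" using p1 by simp
  then have "i1 = i2" using i1 i2 by linarith
  then have "isometric ?G (std_cocycle p i1) ?G f2" using n2 by simp
  then show "isometric ?G f1 ?G f2"
    by (rule isometric_trans[OF ring[OF f1] isometric_sym[OF ring[OF std_cocycle[OF p0 i1]] n1]])
qed

end
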